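(* (Comparison theorem.) Under Assumption A (stated in the context), the following assertions hold. (a) Fix any $k\in I$ and any multipolicy $\bm\pi=(\pi^1,\ldots,\pi^N)\in\bm\Pi$ with $\pi^l=\{\pi_n^l,n\ge0\}$. If a sequence $\{u_n,n\ge0\}$ of functions $u_n\in\mathscr{U}_n^k$ satisfies $$u_n(i,\bm\lambda)\le(\ge)\ T_{n,k}^{\bm\pi_n(\cdot\mid h_n)}u_{n+1}(i,\bm\lambda)$$ for all $(i,\bm\lambda)\in(S_n\setminus D)\times\mathbb{Q}^N$, all $h_n\in\mathbb{H}_n$ (with last state and goal $(i,\bm\lambda)$) and all $n\ge0$, where $\bm\pi_n(\cdot\mid h_n):=(\pi_n^1(\cdot\mid h_n),\ldots,\pi_n^N(\cdot\mid h_n))$, then $$u_0(i,\bm\lambda)\le(\ge)\ F_0^k(i,\bm\lambda,\bm\pi)\qquad\text{for all }(i,\bm\lambda)\in(S_0\setminus D)\times\mathbb{Q}^N.$$ (b) Fix any $k\in I$ and any Markov multipolicy $\bm\pi=(\pi^1,\ldots,\pi^N)\in\bm\Pi_m$ with $\pi^l=\{\phi_n^l,n\ge0\}$. If a sequence $\{u_n,n\ge0\}$ of functions $u_n\in\mathscr{U}_n^k$ satisfies $$u_n(i,\bm\lambda)\le(\ge)\ T_{n,k}^{\bm\phi_n(\cdot\mid i,\bm\lambda)}u_{n+1}(i,\bm\lambda)\qquad\text{for all }(i,\bm\lambda)\in(S_n\setminus D)\times\mathbb{Q}^N,\ n\ge0,$$ where $\bm\phi_n(\cdot\mid i,\bm\lambda):=(\phi_n^1(\cdot\mid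 i,\bm\lambda),\ldots,\phi_n^N(\cdot\mid i,\bm\lambda))$, then $$u_n(i,\bm\lambda)\le(\ge)\ F_n^k(i,\bm\lambda,\bm\pi)\qquad\text{for all }(i,\bm\lambda)\in(S_n\setminus D)\times\mathbb{Q}^N\text{ and }n\ge0.$$ (c) For any fixed $k\in I$ and any Markov multipolicy $\bm\pi=(\pi^1,\ldots,\pi^N)\in\bm\Pi_m$ with $\pi^l=\{\phi_n^l,n\ge0\}$, the sequence $\{F_n^k(i,\bm\lambda,\bm\pi),n\ge0\}$ is the unique solution (among sequences $\{u_n\}$ with $u_n\in\mathscr{U}_n^k$) of $$u_n(i,\bm\lambda)=T_{n,k}^{\bm\phi_n(\cdot\mid i,\bm\lambda)}u_{n+1}(i,\bm\lambda)\qquad\text{for all }(i,\bm\lambda)\in(S_n\setminus D)\times\mathbb{Q}^N\text{ and }n\ge0.$$ In (a) and (b), "$\le(\ge)$" means that the implication holds with $\le$ throughout and also with $\ge$ throughout.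
   Context: Game model. $I=\{1,\ldots,N\}$ is the set of players and $\mathbb{N}_0=\{0,1,\ldots\}$. For each $n\in\mathbb{N}_0$: $S_n$ is a denumerable state space; $A_n^k$ is the action space of player $k$, and $A_n^k(i)\subseteq A_n^k$ is the finite set of actions of player $k$ in state $i\in S_n$; $\bm A_n(i)=\prod_{k=1}^N A_n^k(i)$; $p_n(j\mid i,\bm a)$ is the transition probability from $i\in S_n$ to $j\in S_{n+1}$ under $\bm a\in\bm A_n(i)$; $r_n^k(i,\bm a)\ge0$ is a rational-valued reward of player $k$, and $\bm r_n=(r_n^1,\ldots,r_n^N)$. The target set $D$ is a nonempty subset of $\bigcap_n S_n$, and $p_n(D\mid i,\bm a)=\sum_{j\in D}p_n(j\mid i,\bm a)$. $\mathbb{I}_C$ is the indicator function of a set $C$. Histories. $\mathbb{H}_0=S_0\times\mathbb{Q}^N$, and for $n\ge1$, $\mathbb{H}_n=\{(h_{n-1},\bm a_{n-1},i_n,\bm\lambda_n): h_{n-1}\in\mathbb{H}_{n-1},\ \bm a_{n-1}\in\bm A_{n-1}(i_{n-1}),\ i_n\in S_n,\ \bm\lambda_n\in\mathbb{Q}^N\}$, where $i_{n-1}$ is the last state of $h_{n-1}$. Policies. A randomized history-dependent policy of player $k$ is a sequence $\pi^k=\{\pi_n^k,n\ge0\}$ of stochastic kernels $\pi_n^k$ on $A_n^k$ given $\mathbb{H}_n$ with $\pi_n^k(A_n^k(i_n)\mid h_n)=1$ for every $h_n\in\mathbb{H}_n$, $i_n$ being the last state of $h_n$; $\Pi^k$ is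 the set of these. It is (randomized) Markov, written $\pi^k=\{\phi_n^k,n\ge0\}$, if $\pi_n^k(\cdot\mid h_n)=\phi_n^k(\cdot\mid i_n,\bm\lambda_n)$ for stochastic kernels $\phi_n^k$ on $A_n^k$ given $S_n\times\mathbb{Q}^N$ with $\phi_n^k(A_n^k(i)\mid i,\bm\lambda)=1$; $\Pi_m^k$ is the set of these. $\bm\Pi=\prod_k\Pi^k$, $\bm\Pi_m=\prod_k\Pi_m^k$. Dynamics. For an initial distribution $\gamma$ on $S_0\times\mathbb{Q}^N$ and $\bm\pi\in\bm\Pi$, $\mathbb{P}^{\bm\pi}_\gamma$ is the Ionescu-Tulcea probability measure governing the process $\{X_n,\bm\Lambda_n,Y_n\}_{n\ge0}$ (state, vector of profit goals $\bm\Lambda_n=(\Lambda_n^1,\ldots,\Lambda_n^N)$, action vector $Y_n=(Y_n^1,\ldots,Y_n^N)$): with $H_n=(X_0,\bm\Lambda_0,Y_0,\ldots,X_n,\bm\Lambda_n)$, given $H_n=h_n$ one has $Y_n=\bm a_n=(a_n^1,\ldots,a_n^N)$ with probability $\prod_{k}\pi_n^k(a_n^k\mid h_n)$; given also $Y_n=\bm a_n$, $\bm\Lambda_{n+1}=\bm\lambda_n-\bm r_n(i_n,\bm a_n)$ and $X_{n+1}=i_{n+1}$ with probability $p_n(i_{n+1}\mid i_n,\bm a_n)$. $\mathbb{P}^{\bm\pi}_{(i,\bm\lambda)}$ is the case where $\gamma$ is concentrated at $(i,\bm\lambda)$. First passage times: $\tau_D^n=\inf\{k\ge n: X_k\in D\}$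 for $n\ge0$ ($\inf\emptyset=\infty$), $\tau_D=\tau_D^0$; empty sums are $0$. Criteria, with $\bm\lambda=(\lambda^1,\ldots,\lambda^N)$: for $\bm\pi\in\bm\Pi$ and $(i,\bm\lambda)\in S_0\times\mathbb{Q}^N$, $F_0^k(i,\bm\lambda,\bm\pi)=\mathbb{P}^{\bm\pi}_{(i,\bm\lambda)}\big(\sum_{t=0}^{\tau_D-1}r_t^k(X_t,Y_t)\ge\lambda^k\big)$; for $n\ge1$, $\bm\pi\in\bm\Pi_m$ and $(i,\bm\lambda)\in S_n\times\mathbb{Q}^N$, $F_n^k(i,\bm\lambda,\bm\pi)=\mathbb{P}^{\bm\pi}_\gamma\big(\sum_{t=n}^{\tau_D^n-1}r_t^k(X_t,Y_t)\ge\lambda^k\mid X_n=i,\bm\Lambda_n=\bm\lambda\big)$ (a notation based on the Markov property of the process under Markov policies). Assumption A: for each $\bm\pi\in\bm\Pi$ and $n\ge0$, $\mathbb{P}^{\bm\pi}_\gamma(\tau_D^n<\infty\mid H_n=h_n)=1$ for every $h_n=(i_0,\bm\lambda_0,\bm a_0,\ldots,i_n,\bm\lambda_n)\in\mathbb{H}_n$ with $i_n\in S_n\setminus D$ and $\mathbb{P}^{\bm\pi}_\gamma(H_n=h_n)>0$. $\mathscr{U}_n^k$ is the set of functions $u:(S_n\setminus D)\times\mathbb{Q}^N\to[0,1]$ such that $u(i,\bm\lambda)=1$ for each $i\in S_n\setminus D$ whenever $\lambda^k<0$. $\mathscr{P}(U)$ is the set of probability measures on $U$. For $u\in\mathscr{U}_{n+1}^k$,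 $i\in S_n\setminus D$, $\bm\lambda\in\mathbb{Q}^N$, $\bm a=(a^1,\ldots,a^N)\in\bm A_n(i)$ and $\bm\phi=(\phi^1,\ldots,\phi^N)\in\prod_{l=1}^N\mathscr{P}(A_n^l(i))$: $$T_{n,k}^{\bm a}u(i,\bm\lambda)=\mathbb{I}_{[\lambda^k,\infty)}(r_n^k(i,\bm a))\,p_n(D\mid i,\bm a)+\sum_{j\in S_{n+1}\setminus D}u(j,\bm\lambda-\bm r_n(i,\bm a))\,p_n(j\mid i,\bm a),$$ $$T_{n,k}^{\bm\phi}u(i,\bm\lambda)=\sum_{a^1\in A_n^1(i)}\cdots\sum_{a^N\in A_n^N(i)}T_{n,k}^{\bm a}u(i,\bm\lambda)\,\phi^1(a^1)\cdots\phi^N(a^N).$$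
   Formalization: In (b) and in the uniqueness claim of (c), the conclusion is asserted only for states i in S_n \ D that can be reached at time n from S_0 with positive probability under admissible actions; at other states Assumption A says nothing and the claim fails. *)

theory Defs
  imports "HOL-Probability.Probability"
begin

section \<open>The game model\<close>

text \<open>
  The players are the elements of the finite type \<^typ>\<open>'k\<close>. The ambient action spaces play no
  role beyond containing the finite sets of admissible actions; they are all taken to be the
  type \<^typ>\<open>'a\<close>. A transition law is a \<open>pmf\<close>, so that \<open>pmf (transition G n i a) j\<close> is \<open>p\<^sub>n(j|i,a)\<close>.
\<close>

type_synonym 'k goals = "'k \<Rightarrow> rat"

record ('s, 'k, 'a) game =
  states :: "nat \<Rightarrow> 's set"
  acts :: "nat \<Rightarrow> 'k \<Rightarrow> 's \<Rightarrow> 'a set"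
  transition :: "nat \<Rightarrow> 's \<Rightarrow> ('k \<Rightarrow> 'a) \<Rightarrow> 's pmf"
  reward :: "nat \<Rightarrow> 'k \<Rightarrow> 's \<Rightarrow> ('k \<Rightarrow> 'a) \<Rightarrow> rat"
  target :: "'s set"

definition joint_acts :: "('s, 'k, 'a) game \<Rightarrow> nat \<Rightarrow> 's \<Rightarrow> ('k \<Rightarrow> 'a) set" where
  "joint_acts G n i = {a. \<forall>k. a k \<in> acts G n k i}"

definition game_model :: "('s, 'k::finite, 'a) game \<Rightarrow> bool" where
  "game_model G \<longleftrightarrow>
     (\<forall>n. countable (states G n)) \<and>
     (\<forall>n k. \<forall>i\<in>states G n. finite (acts G n k i)) \<and>
     (\<forall>n. \<forall>i\<in>states G n. \<forall>a\<in>joint_acts G n i. set_pmf (transition G n i a) \<subseteq> states G (Suc n)) \<and>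
     (\<forall>n k. \<forall>i\<in>states G n. \<forall>a\<in>joint_acts G n i. 0 \<le> reward G n k i a) \<and>
     target G \<noteq> {} \<and> target G \<subseteq> (\<Inter>n. states G n)"


section \<open>Histories and policies\<close>

text \<open>
  A history \<open>h\<^sub>n\<close> is the list of the completed stages \<open>(i\<^sub>t, \<lambda>\<^sub>t, a\<^sub>t)\<close>, \<open>t < n\<close>, together with the
  current state and the current vector of profit goals.
\<close>

type_synonym ('s, 'k, 'a) stage = "'s \<times> 'k goals \<times> ('k \<Rightarrow> 'a)"
type_synonym ('s, 'k, 'a) history = "('s, 'k, 'a) stage list \<times> 's \<times> 'k goals"

primrec histories :: "('s, 'k, 'a) game \<Rightarrow> nat \<Rightarrow> ('s, 'k, 'a) history set" where
  "histories G 0 = {([], i, \<mu>) |i \<mu>. i \<in> states G 0}"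
| "histories G (Suc n) =
     {(hs @ [(i, \<mu>, a)], j, \<nu>) |hs i \<mu> a j \<nu>.
        (hs, i, \<mu>) \<in> histories G n \<and> a \<in> joint_acts G n i \<and> j \<in> states G (Suc n)}"

abbreviation cur_state :: "('s, 'k, 'a) history \<Rightarrow> 's" where
  "cur_state h \<equiv> fst (snd h)"

abbreviation cur_goals :: "('s, 'k, 'a) history \<Rightarrow> 'k goals" where
  "cur_goals h \<equiv> snd (snd h)"

type_synonym ('s, 'k, 'a) policy = "nat \<Rightarrow> ('s, 'k, 'a) history \<Rightarrow> 'a pmf"
type_synonym ('s, 'k, 'a) markov_policy = "nat \<Rightarrow> 's \<Rightarrow> 'k goals \<Rightarrow> 'a pmf"

text \<open>
  A stochastic kernel that puts full mass on the finite set of admissible actions is a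
  \<open>pmf\<close>-valued function; its measurability is automatic, since \<open>histories G n\<close> is countable.
\<close>

definition policies :: "('s, 'k, 'a) game \<Rightarrow> 'k \<Rightarrow> ('s, 'k, 'a) policy set" where
  "policies G k = {\<pi>. \<forall>n. \<forall>h\<in>histories G n. set_pmf (\<pi> n h) \<subseteq> acts G n k (cur_state h)}"

definition markov_policies :: "('s, 'k, 'a) game \<Rightarrow> 'k \<Rightarrow> ('s, 'k, 'a) markov_policy set" where
  "markov_policies G k = {\<phi>. \<forall>n. \<forall>i\<in>states G n. \<forall>\<mu>. set_pmf (\<phi> n i \<mu>) \<subseteq> acts G n k i}"

definition multipolicies :: "('s, 'k, 'a) game \<Rightarrow> ('k \<Rightarrow> ('s, 'k, 'a) policy) set" where
  "multipolicies G = {\<pi>. \<forall>k. \<pi> k \<in> policies G k}"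

definition markov_multipolicies ::
    "('s, 'k, 'a) game \<Rightarrow> ('k \<Rightarrow> ('s, 'k, 'a) markov_policy) set" where
  "markov_multipolicies G = {\<phi>. \<forall>k. \<phi> k \<in> markov_policies G k}"

definition of_markov ::
    "('k \<Rightarrow> ('s, 'k, 'a) markov_policy) \<Rightarrow> 'k \<Rightarrow> ('s, 'k, 'a) policy" where
  "of_markov \<phi> = (\<lambda>k n h. \<phi> k n (cur_state h) (cur_goals h))"


section \<open>The process\<close>

type_synonym ('s, 'k, 'a) trajectory = "nat \<Rightarrow> ('s, 'k, 'a) stage"

abbreviation state_at :: "('s, 'k, 'a) trajectory \<Rightarrow> nat \<Rightarrow> 's" where
  "state_at \<omega> n \<equiv> fst (\<omega> n)"

abbreviation goals_at :: "('s, 'k, 'a) trajectory \<Rightarrow> nat \<Rightarrow> 'k goals" where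
  "goals_at \<omega> n \<equiv> fst (snd (\<omega> n))"

abbreviation acts_at :: "('s, 'k, 'a) trajectory \<Rightarrow> nat \<Rightarrow> 'k \<Rightarrow> 'a" where
  "acts_at \<omega> n \<equiv> snd (snd (\<omega> n))"

definition history_at :: "('s, 'k, 'a) trajectory \<Rightarrow> nat \<Rightarrow> ('s, 'k, 'a) history" where
  "history_at \<omega> n = (map \<omega> [0..<n], state_at \<omega> n, goals_at \<omega> n)"

definition stages :: "('s, 'k, 'a) game \<Rightarrow> nat \<Rightarrow> ('s, 'k, 'a) stage set" where
  "stages G n = {(i, \<mu>, a). i \<in> states G n \<and> a \<in> joint_acts G n i}"

definition next_goals ::
    "('s, 'k, 'a) game \<Rightarrow> nat \<Rightarrow> 's \<Rightarrow> 'k goals \<Rightarrow> ('k \<Rightarrow> 'a) \<Rightarrow> 'k goals" where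
  "next_goals G n i \<mu> a = (\<lambda>k. \<mu> k - reward G n k i a)"

definition state_goals_pmf ::
    "('s, 'k, 'a) game \<Rightarrow> ('s \<times> 'k goals) pmf \<Rightarrow> nat \<Rightarrow> ('s, 'k, 'a) trajectory
       \<Rightarrow> ('s \<times> 'k goals) pmf" where
  "state_goals_pmf G \<gamma> n \<omega> = (case n of
       0 \<Rightarrow> \<gamma>
     | Suc m \<Rightarrow> map_pmf (\<lambda>j. (j, next_goals G m (state_at \<omega> m) (goals_at \<omega> m) (acts_at \<omega> m)))
                 (transition G m (state_at \<omega> m) (acts_at \<omega> m)))"

text \<open>
  The players randomise independently given the history. The second argument of \<^const>\<open>Pi_pmf\<close>
  is irrelevant, as the index set is the whole type.
\<close>

definition joint_action_pmf ::
    "('k::finite \<Rightarrow> ('s, 'k, 'a) policy) \<Rightarrow> nat \<Rightarrow> ('s, 'k, 'a) history \<Rightarrow> ('k \<Rightarrow> 'a) pmf" where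
  "joint_action_pmf \<pi> n h = Pi_pmf UNIV undefined (\<lambda>k. \<pi> k n h)"

text \<open>The conditional law of stage \<open>n\<close>, given the stages before it.\<close>

definition stage_pmf ::
    "('s, 'k::finite, 'a) game \<Rightarrow> ('s \<times> 'k goals) pmf \<Rightarrow> ('k \<Rightarrow> ('s, 'k, 'a) policy)
       \<Rightarrow> nat \<Rightarrow> ('s, 'k, 'a) trajectory \<Rightarrow> ('s, 'k, 'a) stage pmf" where
  "stage_pmf G \<gamma> \<pi> n \<omega> =
     bind_pmf (state_goals_pmf G \<gamma> n \<omega>) (\<lambda>(i, \<mu>).
       map_pmf (\<lambda>a. (i, \<mu>, a)) (joint_action_pmf \<pi> n (map \<omega> [0..<n], i, \<mu>)))"

definition stage_space :: "('s, 'k, 'a) game \<Rightarrow> nat \<Rightarrow> ('s, 'k, 'a) stage measure" where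
  "stage_space G n = count_space (stages G n)"

definition stage_kernel ::
    "('s, 'k::finite, 'a) game \<Rightarrow> ('s \<times> 'k goals) pmf \<Rightarrow> ('k \<Rightarrow> ('s, 'k, 'a) policy)
       \<Rightarrow> nat \<Rightarrow> ('s, 'k, 'a) trajectory \<Rightarrow> ('s, 'k, 'a) stage measure" where
  "stage_kernel G \<gamma> \<pi> n \<omega> = restrict_space (measure_pmf (stage_pmf G \<gamma> \<pi> n \<omega>)) (stages G n)"

text \<open>
  The Ionescu-Tulcea measure. That the kernels above satisfy the requirements of the
  construction is \<open>Ionescu_Tulcea_stage_kernel\<close> below.
\<close>

definition law ::
    "('s, 'k::finite, 'a) game \<Rightarrow> ('s \<times> 'k goals) pmf \<Rightarrow> ('k \<Rightarrow> ('s, 'k, 'a) policy)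
       \<Rightarrow> ('s, 'k, 'a) trajectory measure" where
  "law G \<gamma> \<pi> = projective_family.lim UNIV
     (Ionescu_Tulcea.CI (stage_kernel G \<gamma> \<pi>) (stage_space G)) (stage_space G)"

definition initial_distribution :: "('s, 'k, 'a) game \<Rightarrow> ('s \<times> 'k goals) pmf \<Rightarrow> bool" where
  "initial_distribution G \<gamma> \<longleftrightarrow> set_pmf \<gamma> \<subseteq> states G 0 \<times> UNIV"


section \<open>First passage times and criteria\<close>

definition passage_time :: "('s, 'k, 'a) game \<Rightarrow> nat \<Rightarrow> ('s, 'k, 'a) trajectory \<Rightarrow> enat" where
  "passage_time G n \<omega> = Inf {enat t |t. n \<le> t \<and> state_at \<omega> t \<in> target G}"

text \<open>The reward collected from time \<open>n\<close> on may be infinite if the target is never reached.\<close>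

definition passage_reward ::
    "('s, 'k, 'a) game \<Rightarrow> nat \<Rightarrow> 'k \<Rightarrow> ('s, 'k, 'a) trajectory \<Rightarrow> ereal" where
  "passage_reward G n k \<omega> =
     (\<Sum>t. if n \<le> t \<and> enat t < passage_time G n \<omega>
           then ereal (of_rat (reward G t k (state_at \<omega> t) (acts_at \<omega> t))) else 0)"

definition F0 ::
    "('s, 'k::finite, 'a) game \<Rightarrow> ('k \<Rightarrow> ('s, 'k, 'a) policy) \<Rightarrow> 'k \<Rightarrow> 's \<Rightarrow> 'k goals \<Rightarrow> real" where
  "F0 G \<pi> k i \<mu> =
     \<P>(\<omega> in law G (return_pmf (i, \<mu>)) \<pi>. ereal (of_rat (\<mu> k)) \<le> passage_reward G 0 k \<omega>)"

text \<open>
  \<open>F\<^sub>n\<close> is a conditional probability given \<open>X\<^sub>n = i\<close>, \<open>\<Lambda>\<^sub>n = \<lambda>\<close>, which under a Markov multipolicy is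
  the law of the process started at time \<open>n\<close> in \<open>(i, \<lambda>)\<close>; this gives it a meaning also when the
  conditioning event is a null event under the multipolicy at hand. The process started at time
  \<open>n\<close> is realised by moving the time origin of the game and of the policies to \<open>n\<close>. The lemma
  \<open>F_eq_cond_prob\<close> below shows that this is the conditional probability whenever the
  conditioning event has positive probability.
\<close>

definition shift_game :: "nat \<Rightarrow> ('s, 'k, 'a) game \<Rightarrow> ('s, 'k, 'a) game" where
  "shift_game n G =
     \<lparr>states = (\<lambda>t. states G (n + t)), acts = (\<lambda>t. acts G (n + t)),
      transition = (\<lambda>t. transition G (n + t)), reward = (\<lambda>t. reward G (n + t)), target = target G\<rparr>"

definition F ::
    "('s, 'k::finite, 'a) game \<Rightarrow> ('k \<Rightarrow> ('s, 'k, 'a) markov_policy) \<Rightarrow> nat \<Rightarrow> 'k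
       \<Rightarrow> 's \<Rightarrow> 'k goals \<Rightarrow> real" where
  "F G \<phi> n k i \<mu> = F0 (shift_game n G) (of_markov (\<lambda>l t. \<phi> l (n + t))) k i \<mu>"

definition assumption_A :: "('s, 'k::finite, 'a) game \<Rightarrow> bool" where
  "assumption_A G \<longleftrightarrow>
     (\<forall>\<gamma> \<pi> n h. initial_distribution G \<gamma> \<longrightarrow> \<pi> \<in> multipolicies G \<longrightarrow>
        h \<in> histories G n \<longrightarrow> cur_state h \<notin> target G \<longrightarrow>
        0 < \<P>(\<omega> in law G \<gamma> \<pi>. history_at \<omega> n = h) \<longrightarrow>
        \<P>(\<omega> in law G \<gamma> \<pi>. passage_time G n \<omega> < \<infinity> \<bar> history_at \<omega> n = h) = 1)"

text \<open>
  The states that can occur at time \<open>n\<close>. A state that is not attainable has probability zero under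
  all initial distributions and multipolicies, so no conditional probability given \<open>X\<^sub>n = i\<close> is
  ever defined there, and \<^const>\<open>assumption_A\<close> says nothing about it.
\<close>

inductive attainable :: "('s, 'k, 'a) game \<Rightarrow> nat \<Rightarrow> 's \<Rightarrow> bool" for G where
  start: "i \<in> states G 0 \<Longrightarrow> attainable G 0 i"
| step: "attainable G n i \<Longrightarrow> a \<in> joint_acts G n i \<Longrightarrow> 0 < pmf (transition G n i a) j
           \<Longrightarrow> attainable G (Suc n) j"


section \<open>Operators\<close>

definition goal_functions :: "('s, 'k, 'a) game \<Rightarrow> nat \<Rightarrow> 'k \<Rightarrow> ('s \<Rightarrow> 'k goals \<Rightarrow> real) set" where
  "goal_functions G n k =
     {u. \<forall>i\<in>states G n - target G. \<forall>\<mu>. u i \<mu> \<in> {0..1} \<and> (\<mu> k < 0 \<longrightarrow> u i \<mu> = 1)}"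

definition T_action ::
    "('s, 'k, 'a) game \<Rightarrow> nat \<Rightarrow> 'k \<Rightarrow> ('k \<Rightarrow> 'a) \<Rightarrow> ('s \<Rightarrow> 'k goals \<Rightarrow> real)
       \<Rightarrow> 's \<Rightarrow> 'k goals \<Rightarrow> real" where
  "T_action G n k a u i \<mu> =
     indicator {\<mu> k..} (reward G n k i a) * (\<Sum>\<^sub>\<infinity>j\<in>target G. pmf (transition G n i a) j) +
     (\<Sum>\<^sub>\<infinity>j\<in>states G (Suc n) - target G. u j (next_goals G n i \<mu> a) * pmf (transition G n i a) j)"

definition T_mixed ::
    "('s, 'k::finite, 'a) game \<Rightarrow> nat \<Rightarrow> 'k \<Rightarrow> ('k \<Rightarrow> 'a pmf) \<Rightarrow> ('s \<Rightarrow> 'k goals \<Rightarrow> real)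
       \<Rightarrow> 's \<Rightarrow> 'k goals \<Rightarrow> real" where
  "T_mixed G n k \<phi> u i \<mu> =
     (\<Sum>a\<in>joint_acts G n i. T_action G n k a u i \<mu> * (\<Prod>l\<in>UNIV. pmf (\<phi> l) (a l)))"


section \<open>Adequacy of the process and of the criteria\<close>

lemma histories_eq:
  "(hs, i, \<mu>) \<in> histories G n \<longleftrightarrow>
     length hs = n \<and> (\<forall>t<n. hs ! t \<in> stages G t) \<and> i \<in> states G n"
proof (induction n arbitrary: hs i \<mu>)
  case (Suc n)
  show ?case
  proof (cases hs rule: rev_cases)
    case (snoc hs' x)
    obtain i' \<mu>' a' where x: "x = (i', \<mu>', a')" by (cases x)
    have "(hs, i, \<mu>) \<in> histories G (Suc n) \<longleftrightarrow>
        (hs', i', \<mu>') \<in> histories G n \<and> a' \<in> joint_acts G n i' \<and> i \<in> states G (Suc n)"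
      by (auto simp: snoc x)
    moreover have "x \<in> stages G n \<longleftrightarrow> i' \<in> states G n \<and> a' \<in> joint_acts G n i'"
      by (simp add: x stages_def)
    moreover have "(\<forall>t<Suc n. hs ! t \<in> stages G t) \<longleftrightarrow>
        (\<forall>t<n. hs' ! t \<in> stages G t) \<and> x \<in> stages G n" if "length hs' = n"
      unfolding All_less_Suc using that by (auto simp: snoc nth_append)
    ultimately show ?thesis
      unfolding Suc.IH using snoc by (cases "length hs' = n") simp_all
  qed auto
qed auto

lemma countable_stages:
  assumes "game_model G" shows "countable (stages G n)"
proof -
  have "finite (joint_acts G n i)" if "i \<in> states G n" for i
  proof -
    have "joint_acts G n i = PiE UNIV (\<lambda>k. acts G n k i)"
      by (auto simp: joint_acts_def)
    then show ?thesis using assms that by (auto simp: game_model_def intro!: finite_PiE)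
  qed
  then have "countable (SIGMA i:states G n. (UNIV :: 'b goals set) \<times> joint_acts G n i)"
    using assms by (intro countable_SIGMA) (auto simp: game_model_def intro: countable_finite)
  also have "(SIGMA i:states G n. (UNIV :: 'b goals set) \<times> joint_acts G n i) = stages G n"
    by (auto simp: stages_def)
  finally show ?thesis .
qed

lemma set_joint_action_pmf:
  assumes "\<pi> \<in> multipolicies G" "h \<in> histories G n"
  shows "set_pmf (joint_action_pmf \<pi> n h) \<subseteq> joint_acts G n (cur_state h)"
  using assms unfolding joint_action_pmf_def multipolicies_def policies_def joint_acts_def
  by (auto simp: set_Pi_pmf PiE_dflt_def subset_iff)

lemma set_state_goals_pmf:
  assumes "game_model G" "initial_distribution G \<gamma>" "\<And>t. t < n \<Longrightarrow> \<omega> t \<in> stages G t"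
  shows "set_pmf (state_goals_pmf G \<gamma> n \<omega>) \<subseteq> states G n \<times> UNIV"
proof (cases n)
  case (Suc m)
  with assms(3)[of m] have "\<omega> m \<in> stages G m" by simp
  then have "set_pmf (transition G m (state_at \<omega> m) (acts_at \<omega> m)) \<subseteq> states G n"
    using assms(1) Suc unfolding game_model_def stages_def by (cases "\<omega> m") auto
  then show ?thesis by (auto simp: state_goals_pmf_def Suc)
qed (use assms(2) in \<open>auto simp: state_goals_pmf_def initial_distribution_def\<close>)

lemma set_stage_pmf:
  assumes "game_model G" "initial_distribution G \<gamma>" "\<pi> \<in> multipolicies G"
    "\<And>t. t < n \<Longrightarrow> \<omega> t \<in> stages G t"
  shows "set_pmf (stage_pmf G \<gamma> \<pi> n \<omega>) \<subseteq> stages G n"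
proof
  fix s assume "s \<in> set_pmf (stage_pmf G \<gamma> \<pi> n \<omega>)"
  then obtain i \<mu> a where s: "s = (i, \<mu>, a)" "(i, \<mu>) \<in> set_pmf (state_goals_pmf G \<gamma> n \<omega>)"
    "a \<in> set_pmf (joint_action_pmf \<pi> n (map \<omega> [0..<n], i, \<mu>))"
    by (auto simp: stage_pmf_def)
  with set_state_goals_pmf[OF assms(1,2,4)] have i: "i \<in> states G n" by auto
  then have "(map \<omega> [0..<n], i, \<mu>) \<in> histories G n"
    using assms(4) by (auto simp: histories_eq)
  from set_joint_action_pmf[OF assms(3) this] s i show "s \<in> stages G n"
    by (auto simp: stages_def)
qed

lemma stage_pmf_cong:
  assumes "\<And>t. t < n \<Longrightarrow> \<omega> t = \<omega>' t"
  shows "stage_pmf G \<gamma> \<pi> n \<omega> = stage_pmf G \<gamma> \<pi> n \<omega>'"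
proof -
  have *: "map \<omega> [0..<n] = map \<omega>' [0..<n]" using assms by auto
  have "state_goals_pmf G \<gamma> n \<omega> = state_goals_pmf G \<gamma> n \<omega>'"
    using assms by (cases n) (auto simp: state_goals_pmf_def)
  then show ?thesis unfolding stage_pmf_def * by simp
qed

lemma pmf_stage_pmf:
  "pmf (stage_pmf G \<gamma> \<pi> n \<omega>) (i, \<mu>, a) =
     pmf (state_goals_pmf G \<gamma> n \<omega>) (i, \<mu>) *
     pmf (joint_action_pmf \<pi> n (map \<omega> [0..<n], i, \<mu>)) a"
proof -
  have "ennreal (pmf (stage_pmf G \<gamma> \<pi> n \<omega>) (i, \<mu>, a)) =
     (\<integral>\<^sup>+x. ennreal (pmf (joint_action_pmf \<pi> n (map \<omega> [0..<n], i, \<mu>)) a) * indicator {(i, \<mu>)} x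
        \<partial>measure_pmf (state_goals_pmf G \<gamma> n \<omega>))"
    unfolding stage_pmf_def ennreal_pmf_bind
  proof (intro nn_integral_cong, clarify)
    fix i' \<mu>'
    show "ennreal (pmf (map_pmf (\<lambda>a. (i', \<mu>', a)) (joint_action_pmf \<pi> n (map \<omega> [0..<n], i', \<mu>'))) (i, \<mu>, a))
      = ennreal (pmf (joint_action_pmf \<pi> n (map \<omega> [0..<n], i, \<mu>)) a) * indicator {(i, \<mu>)} (i', \<mu>')"
    proof (cases "(i', \<mu>') = (i, \<mu>)")
      case True
      then show ?thesis
        using pmf_map_inj'[of "\<lambda>a. (i, \<mu>, a)" "joint_action_pmf \<pi> n (map \<omega> [0..<n], i, \<mu>)" a]
        by (simp add: inj_def)
    next
      case False
      then have "pmf (map_pmf (\<lambda>a. (i', \<mu>', a)) (joint_action_pmf \<pi> n (map \<omega> [0..<n], i', \<mu>'))) (i, \<mu>, a) = 0"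
        by (auto simp: pmf_eq_0_set_pmf)
      with False show ?thesis by auto
    qed
  qed
  also have "\<dots> = ennreal (pmf (state_goals_pmf G \<gamma> n \<omega>) (i, \<mu>) *
     pmf (joint_action_pmf \<pi> n (map \<omega> [0..<n], i, \<mu>)) a)"
    by (subst nn_integral_cmult_indicator)
       (auto simp: emeasure_pmf_single ennreal_mult' mult.commute)
  finally show ?thesis by (simp add: ennreal_inj)
qed

lemma space_PiM_stage_space:
  "space (PiM J (stage_space G)) = PiE J (stages G)"
  by (auto simp: space_PiM stage_space_def)

lemma PiM_stage_space_finite:
  assumes "game_model G" "finite J"
  shows "PiM J (stage_space G) = count_space (PiE J (stages G))"
  unfolding stage_space_def
  using assms by (intro count_space_PiM_finite countable_stages)

lemma sets_stage_kernel: "sets (stage_kernel G \<gamma> \<pi> n \<omega>) = Pow (stages G n)"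
  by (auto simp: stage_kernel_def sets_restrict_space)

lemma emeasure_stage_kernel:
  "A \<subseteq> stages G n \<Longrightarrow>
     emeasure (stage_kernel G \<gamma> \<pi> n \<omega>) A = emeasure (measure_pmf (stage_pmf G \<gamma> \<pi> n \<omega>)) A"
  unfolding stage_kernel_def by (intro emeasure_restrict_space) auto

lemma prob_space_stage_kernel:
  assumes "game_model G" "initial_distribution G \<gamma>" "\<pi> \<in> multipolicies G"
    "\<omega> \<in> PiE {0..<n} (stages G)"
  shows "prob_space (stage_kernel G \<gamma> \<pi> n \<omega>)"
proof
  have "set_pmf (stage_pmf G \<gamma> \<pi> n \<omega>) \<subseteq> stages G n"
    using assms by (intro set_stage_pmf) (auto simp: PiE_iff)
  moreover have "space (stage_kernel G \<gamma> \<pi> n \<omega>) = stages G n"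
    by (simp add: stage_kernel_def space_restrict_space)
  ultimately show "emeasure (stage_kernel G \<gamma> \<pi> n \<omega>) (space (stage_kernel G \<gamma> \<pi> n \<omega>)) = 1"
    by (auto simp: emeasure_stage_kernel measure_pmf.emeasure_eq_measure measure_pmf.prob_eq_1
          AE_measure_pmf_iff)
qed

lemma Ionescu_Tulcea_stage_kernel:
  assumes "game_model G" "initial_distribution G \<gamma>" "\<pi> \<in> multipolicies G"
  shows "Ionescu_Tulcea (stage_kernel G \<gamma> \<pi>) (stage_space G)"
proof (rule Ionescu_Tulcea.intro)
  show "stage_kernel G \<gamma> \<pi> n \<in> measurable (PiM {0..<n} (stage_space G)) (subprob_algebra (stage_space G n))" for n
    unfolding PiM_stage_space_finite[OF assms(1) finite_atLeastLessThan]
    by (auto simp: space_subprob_algebra sets_stage_kernel stage_space_def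
          intro!: prob_space_imp_subprob_space prob_space_stage_kernel[OF assms])
  show "prob_space (stage_kernel G \<gamma> \<pi> n \<omega>)" if "\<omega> \<in> space (PiM {0..<n} (stage_space G))" for n \<omega>
    using that by (intro prob_space_stage_kernel[OF assms]) (simp add: space_PiM_stage_space)
qed

lemma sets_law:
  assumes "game_model G" "initial_distribution G \<gamma>" "\<pi> \<in> multipolicies G"
  shows "sets (law G \<gamma> \<pi>) = sets (PiM UNIV (stage_space G))"
proof -
  interpret IT: Ionescu_Tulcea "stage_kernel G \<gamma> \<pi>" "stage_space G"
    by (rule Ionescu_Tulcea_stage_kernel[OF assms])
  show ?thesis unfolding law_def by simp
qed

lemma space_law:
  assumes "game_model G" "initial_distribution G \<gamma>" "\<pi> \<in> multipolicies G"
  shows "space (law G \<gamma> \<pi>) = PiE UNIV (stages G)"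
  using sets_eq_imp_space_eq[OF sets_law[OF assms]] by (simp add: space_PiM_stage_space)

lemma prob_space_law:
  assumes "game_model G" "initial_distribution G \<gamma>" "\<pi> \<in> multipolicies G"
  shows "prob_space (law G \<gamma> \<pi>)"
proof -
  interpret IT: Ionescu_Tulcea "stage_kernel G \<gamma> \<pi>" "stage_space G"
    by (rule Ionescu_Tulcea_stage_kernel[OF assms])
  have "emeasure (law G \<gamma> \<pi>) (IT.PF.emb UNIV {} (PiE {} (stages G))) = emeasure (IT.CI {}) (PiE {} (stages G))"
    unfolding law_def by (rule IT.lim) (auto simp: PiM_stage_space_finite[OF assms(1)])
  also have "PiE {} (stages G) = space (IT.CI {})"
    by (simp add: IT.CI_def space_PiM_stage_space)
  also have "emeasure (IT.CI {}) (space (IT.CI {})) = 1"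
    by (intro prob_space.emeasure_space_1 IT.PF.prob_space_P) auto
  also have "IT.PF.emb UNIV {} (space (IT.CI {})) = space (law G \<gamma> \<pi>)"
    by (auto simp: prod_emb_def IT.CI_def space_PiM_stage_space space_law[OF assms] space_PiM stage_space_def)
  finally show ?thesis by (intro prob_spaceI)
qed

definition cyl :: "('s, 'k, 'a) game \<Rightarrow> nat \<Rightarrow> ('s, 'k, 'a) trajectory \<Rightarrow> ('s, 'k, 'a) trajectory set" where
  "cyl G n x = {\<omega> \<in> PiE UNIV (stages G). \<forall>t<n. \<omega> t = x t}"

lemma emeasure_law_cyl:
  assumes "game_model G" "initial_distribution G \<gamma>" "\<pi> \<in> multipolicies G"
    and x: "\<And>t. t < n \<Longrightarrow> x t \<in> stages G t"
  shows "emeasure (law G \<gamma> \<pi>) (cyl G n x) = ennreal (\<Prod>t<n. pmf (stage_pmf G \<gamma> \<pi> t x) (x t))"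
proof -
  interpret IT: Ionescu_Tulcea "stage_kernel G \<gamma> \<pi>" "stage_space G"
    by (rule Ionescu_Tulcea_stage_kernel[OF assms(1-3)])
  note count = PiM_stage_space_finite[OF assms(1) finite_atLeastLessThan]
  have C: "emeasure (IT.C 0 n (\<lambda>_. undefined)) {restrict x {0..<n}} =
      ennreal (\<Prod>t<n. pmf (stage_pmf G \<gamma> \<pi> t x) (x t))"
    using x
  proof (induction n)
    case 0
    show ?case by (simp add: PiM_empty restrict_def)
  next
    case (Suc n)
    let ?x = "restrict x {0..<n}" and ?x' = "restrict x {0..<Suc n}"
    let ?C = "IT.C 0 n (\<lambda>_. undefined)"
    have sets_C: "sets ?C = Pow (PiE {0..<n} (stages G))"
      by (subst IT.sets_C) (auto simp: space_PiM_stage_space count)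
    have space_C: "space ?C = PiE {0..<n} (stages G)"
      by (subst IT.space_C) (auto simp: space_PiM_stage_space)
    have x_in: "?x \<in> PiE {0..<n} (stages G)" "?x' \<in> PiE {0..<Suc n} (stages G)"
      using Suc.prems by (auto simp: PiE_iff)
    have eP: "emeasure (IT.eP n \<omega>) {?x'} =
        ennreal (pmf (stage_pmf G \<gamma> \<pi> n x) (x n)) * indicator {?x} \<omega>"
      if \<omega>: "\<omega> \<in> PiE {0..<n} (stages G)" for \<omega>
    proof -
      have eq: "fun_upd \<omega> n y = ?x' \<longleftrightarrow> \<omega> = ?x \<and> y = x n" for y
      proof
        assume "fun_upd \<omega> n y = ?x'"
        then have *: "(fun_upd \<omega> n y) t = ?x' t" for t by simp
        have "y = x n" using *[of n] by simp
        moreover have "\<omega> t = ?x t" for t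
          using *[of t] \<omega> by (cases "t = n") (auto simp: PiE_iff extensional_def restrict_def split: if_splits)
        ultimately show "\<omega> = ?x \<and> y = x n" by auto
      qed (auto simp: fun_eq_iff restrict_def)
      have "emeasure (IT.eP n \<omega>) {?x'} = emeasure (stage_kernel G \<gamma> \<pi> n \<omega>)
          ((\<lambda>y. fun_upd \<omega> n y) -` {?x'} \<inter> space (stage_space G n))"
        using \<omega> x_in by (intro IT.emeasure_eP) (auto simp: space_PiM_stage_space count)
      also have "(\<lambda>y. fun_upd \<omega> n y) -` {?x'} \<inter> space (stage_space G n) = (if \<omega> = ?x then {x n} else {})"
        unfolding vimage_def singleton_iff eq using Suc.prems[of n] by (auto simp: stage_space_def)
      also have "emeasure (stage_kernel G \<gamma> \<pi> n \<omega>) (if \<omega> = ?x then {x n} else {}) =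
          ennreal (pmf (stage_pmf G \<gamma> \<pi> n ?x) (x n)) * indicator {?x} \<omega>"
        using Suc.prems[of n]
        by (auto simp: emeasure_stage_kernel emeasure_pmf_single)
      also have "stage_pmf G \<gamma> \<pi> n ?x = stage_pmf G \<gamma> \<pi> n x"
        by (rule stage_pmf_cong) auto
      finally show ?thesis .
    qed
    have "emeasure (IT.C 0 (Suc n) (\<lambda>_. undefined)) {?x'} = (\<integral>\<^sup>+\<omega>. emeasure (IT.eP n \<omega>) {?x'} \<partial>?C)"
    proof -
      have m: "IT.eP n \<in> measurable ?C (subprob_algebra (PiM {0..<Suc n} (stage_space G)))"
      proof -
        have "sets ?C = sets (PiM {0..<0 + n} (stage_space G))"
          by (rule IT.sets_C) (simp add: space_PiM_stage_space)
        then have "measurable ?C (subprob_algebra (PiM {0..<Suc n} (stage_space G))) =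
            measurable (PiM {0..<n} (stage_space G)) (subprob_algebra (PiM {0..<Suc n} (stage_space G)))"
          by (intro measurable_cong_sets) simp_all
        then show ?thesis using IT.measurable_eP[of n] by blast
      qed
      have ne: "space ?C \<noteq> {}" unfolding space_C using x_in by blast
      have "{?x'} \<in> sets (PiM {0..<Suc n} (stage_space G))"
        using x_in unfolding count by (simp del: PiE_iff)
      from emeasure_bind[OF ne m this] show ?thesis by simp
    qed
    also have "\<dots> = (\<integral>\<^sup>+\<omega>. ennreal (pmf (stage_pmf G \<gamma> \<pi> n x) (x n)) * indicator {?x} \<omega> \<partial>?C)"
      by (intro nn_integral_cong) (simp add: eP space_C)
    also have "\<dots> = ennreal (pmf (stage_pmf G \<gamma> \<pi> n x) (x n)) * emeasure ?C {?x}"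
      using x_in by (intro nn_integral_cmult_indicator) (simp add: sets_C)
    also have "emeasure ?C {?x} = ennreal (\<Prod>t<n. pmf (stage_pmf G \<gamma> \<pi> t x) (x t))"
      by (rule Suc.IH) (use Suc.prems in auto)
    finally show ?case
      by (simp add: ennreal_mult[symmetric] prod_nonneg mult.commute)
  qed
  have x_in: "restrict x {0..<n} \<in> PiE {0..<n} (stages G)"
    using x by (auto simp: PiE_iff)
  have "cyl G n x = prod_emb UNIV (stage_space G) {0..<n} {restrict x {0..<n}}"
  proof -
    have "restrict \<omega> {0..<n} = restrict x {0..<n} \<longleftrightarrow> (\<forall>t<n. \<omega> t = x t)" for \<omega>
      unfolding fun_eq_iff restrict_def by (metis atLeastLessThan_iff zero_le)
    then show ?thesis by (auto simp: cyl_def prod_emb_def stage_space_def space_PiM)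
  qed
  also have "emeasure (law G \<gamma> \<pi>) \<dots> = emeasure (IT.CI {0..<n}) {restrict x {0..<n}}"
    unfolding law_def using x_in by (intro IT.lim) (auto simp: count)
  also have "\<dots> = emeasure (IT.C 0 n (\<lambda>_. undefined))
      (prod_emb {0..<n} (stage_space G) {0..<n} {restrict x {0..<n}})"
    using x_in by (intro IT.emeasure_CI) (auto simp: count)
  also have "prod_emb {0..<n} (stage_space G) {0..<n} {restrict x {0..<n}} = {restrict x {0..<n}}"
    using x_in by (intro prod_emb_id) (auto simp: stage_space_def)
  finally show ?thesis using C by simp
qed


lemma cyl_in_sets:
  assumes "\<And>t. t < n \<Longrightarrow> x t \<in> stages G t"
  shows "cyl G n x \<in> sets (PiM UNIV (stage_space G))"
proof -
  have "cyl G n x = {\<omega> \<in> space (PiM UNIV (stage_space G)). \<forall>t\<in>{..<n}. \<omega> t \<in> {x t}}"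
    by (auto simp: cyl_def space_PiM_stage_space)
  also have "\<dots> \<in> sets (PiM UNIV (stage_space G))"
    using assms by (intro sets.sets_Collect_finite_All sets_Collect_single) (auto simp: stage_space_def)
  finally show ?thesis .
qed

lemma sets_PiM_stage_space_cyl:
  assumes gm: "game_model G" and y0: "\<And>t. y0 t \<in> stages G t"
  shows "sets (PiM UNIV (stage_space G)) =
    sigma_sets (PiE UNIV (stages G)) ({cyl G (Suc m) y |m y. \<forall>t. y t \<in> stages G t} \<union> {{}})"
    (is "_ = sigma_sets ?\<Omega> ?E")
proof
  show "sigma_sets ?\<Omega> ?E \<subseteq> sets (PiM UNIV (stage_space G))"
    using sets.sigma_sets_subset[of ?E "PiM UNIV (stage_space G)"]
    by (auto simp: space_PiM_stage_space intro!: cyl_in_sets)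
  have "sigma_sets ?\<Omega> {{f \<in> ?\<Omega>. f i \<in> A} |i A. i \<in> UNIV \<and> A \<in> sets (stage_space G i)} \<subseteq> sigma_sets ?\<Omega> ?E"
  proof (rule sigma_sets_mono, rule subsetI)
    fix B assume "B \<in> {{f \<in> ?\<Omega>. f i \<in> A} |i A. i \<in> UNIV \<and> A \<in> sets (stage_space G i)}"
    then obtain i A where B: "B = {f \<in> ?\<Omega>. f i \<in> A}" by blast
    let ?X = "{x \<in> PiE {0..<Suc i} (stages G). x i \<in> A}"
    let ?y = "\<lambda>x t. if t < Suc i then x t else y0 t"
    have "{f \<in> ?\<Omega>. f i \<in> A} = (\<Union>x\<in>?X. cyl G (Suc i) (?y x))"
    proof (intro equalityI subsetI)
      fix f assume f: "f \<in> {f \<in> ?\<Omega>. f i \<in> A}"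
      then have "restrict f {0..<Suc i} \<in> ?X" by (auto simp: PiE_iff)
      moreover have "f \<in> cyl G (Suc i) (?y (restrict f {0..<Suc i}))"
        using f by (auto simp: cyl_def)
      ultimately show "f \<in> (\<Union>x\<in>?X. cyl G (Suc i) (?y x))" by blast
    qed (auto simp: cyl_def)
    also have "\<dots> \<in> sigma_sets ?\<Omega> ?E"
    proof (rule sigma_sets_UNION)
      have "countable (PiE {0..<Suc i} (stages G))"
        using countable_stages[OF gm] by (intro countable_PiE) auto
      then have "countable ?X" by (rule countable_subset[rotated]) auto
      then show "countable ((\<lambda>x. cyl G (Suc i) (?y x)) ` ?X)" by simp
    next
      fix b assume "b \<in> (\<lambda>x. cyl G (Suc i) (?y x)) ` ?X"
      then obtain x where x: "x \<in> ?X" "b = cyl G (Suc i) (?y x)" by blast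
      then have "\<forall>t. ?y x t \<in> stages G t" using y0 by (auto simp: PiE_iff)
      with x(2) show "b \<in> sigma_sets ?\<Omega> ?E" by (intro sigma_sets.Basic) blast
    qed
    finally show "B \<in> sigma_sets ?\<Omega> ?E" unfolding B .
  qed
  then show "sets (PiM UNIV (stage_space G)) \<subseteq> sigma_sets ?\<Omega> ?E"
    unfolding sets_PiM_single by (simp add: stage_space_def)
qed

lemma Int_stable_cyl: "Int_stable ({cyl G (Suc m) y |m y. \<forall>t. y t \<in> stages G t} \<union> {{}})"
proof -
  let ?E = "{cyl G (Suc m) y |m y. \<forall>t. y t \<in> stages G t} \<union> {{}}"
  have *: "cyl G (Suc m) y \<inter> cyl G (Suc m') y' \<in> ?E"
    if le: "m \<le> m'" and y: "\<forall>t. y t \<in> stages G t" "\<forall>t. y' t \<in> stages G t" for m m' y y'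
  proof (cases "\<forall>t<Suc m. y t = y' t")
    case True
    then have "cyl G (Suc m) y \<inter> cyl G (Suc m') y' = cyl G (Suc m') y'"
      using le by (auto simp: cyl_def)
    then show ?thesis using y by blast
  next
    case False
    then obtain t where t: "t < Suc m" "y t \<noteq> y' t" by blast
    have "cyl G (Suc m) y \<inter> cyl G (Suc m') y' = {}"
    proof (rule equals0I)
      fix \<omega> assume "\<omega> \<in> cyl G (Suc m) y \<inter> cyl G (Suc m') y'"
      then have "\<omega> t = y t" "\<omega> t = y' t" using t(1) le by (auto simp: cyl_def)
      with t(2) show False by simp
    qed
    then show ?thesis by simp
  qed
  show ?thesis
  proof (rule Int_stableI)
    fix a b assume ab: "a \<in> ?E" "b \<in> ?E"
    show "a \<inter> b \<in> ?E"
    proof (cases "a = {} \<or> b = {}")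
      case False
      with ab obtain m y m' y' where "a = cyl G (Suc m) y" "b = cyl G (Suc m') y'"
        "\<forall>t. y t \<in> stages G t" "\<forall>t. y' t \<in> stages G t" by blast
      then show ?thesis using *[of m m' y y'] *[of m' m y' y]
        by (cases "m \<le> m'") (simp_all add: Int_commute)
    qed auto
  qed
qed

lemma shift_game_sel [simp]:
  "states (shift_game n G) t = states G (n + t)"
  "transition (shift_game n G) t = transition G (n + t)"
  "reward (shift_game n G) t = reward G (n + t)"
  "target (shift_game n G) = target G"
  by (simp_all add: shift_game_def)

lemma game_model_shift: "game_model G \<Longrightarrow> game_model (shift_game n G)"
  by (auto simp: game_model_def shift_game_def joint_acts_def)

lemma stages_shift: "stages (shift_game n G) t = stages G (n + t)"
  by (auto simp: stages_def shift_game_def joint_acts_def)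

lemma stage_space_shift: "stage_space (shift_game n G) t = stage_space G (n + t)"
  by (simp add: stage_space_def stages_shift)

lemma of_markov_multipolicies:
  assumes "\<phi> \<in> markov_multipolicies G" shows "of_markov \<phi> \<in> multipolicies G"
proof -
  have "cur_state h \<in> states G n" if "h \<in> histories G n" for h n
    using that by (cases h) (auto simp: histories_eq)
  with assms show ?thesis
    unfolding markov_multipolicies_def markov_policies_def multipolicies_def policies_def of_markov_def
    by auto
qed

lemma markov_multipolicies_shift:
  "\<phi> \<in> markov_multipolicies G \<Longrightarrow> (\<lambda>l t. \<phi> l (n + t)) \<in> markov_multipolicies (shift_game n G)"
  by (auto simp: markov_multipolicies_def markov_policies_def shift_game_def)

lemma less_passage_time_iff:
  "enat t < passage_time G n \<omega> \<longleftrightarrow> (\<forall>s\<in>{n..t}. state_at \<omega> s \<notin> target G)"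
proof
  assume t: "enat t < passage_time G n \<omega>"
  show "\<forall>s\<in>{n..t}. state_at \<omega> s \<notin> target G"
  proof (intro ballI notI)
    fix s assume s: "s \<in> {n..t}" "state_at \<omega> s \<in> target G"
    then have "passage_time G n \<omega> \<le> enat s"
      unfolding passage_time_def by (intro Inf_lower) auto
    also have "\<dots> \<le> enat t" using s by simp
    finally show False using t by simp
  qed
next
  assume *: "\<forall>s\<in>{n..t}. state_at \<omega> s \<notin> target G"
  have "enat (Suc t) \<le> passage_time G n \<omega>"
    unfolding passage_time_def
  proof (rule Inf_greatest, clarify)
    fix s assume "n \<le> s" "state_at \<omega> s \<in> target G"
    with * show "enat (Suc t) \<le> enat s" by (simp add: Suc_le_eq) (meson atLeastAtMost_iff not_le)
  qed
  then show "enat t < passage_time G n \<omega>"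
    by (meson enat_ord_simps(2) lessI less_le_trans)
qed

lemma passage_reward_shift:
  "passage_reward G n k \<omega> = passage_reward (shift_game n G) 0 k (\<lambda>t. \<omega> (n + t))"
proof -
  let ?f = "\<lambda>t. if n \<le> t \<and> enat t < passage_time G n \<omega>
           then ereal (of_rat (reward G t k (state_at \<omega> t) (acts_at \<omega> t))) else 0"
  have "(\<forall>s\<in>{n..n + t}. state_at \<omega> s \<notin> target G) \<longleftrightarrow>
        (\<forall>s\<in>{0..t}. state_at \<omega> (n + s) \<notin> target G)" for t
    by (metis (no_types, lifting) add_le_cancel_left atLeastAtMost_iff le_add1 le_add_diff_inverse zero_le)
  then have "passage_reward (shift_game n G) 0 k (\<lambda>t. \<omega> (n + t)) = (\<Sum>t. ?f (n + t))"
    unfolding passage_reward_def by (simp add: less_passage_time_iff cong: if_cong)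
  also have "\<dots> = (\<Sum>t. ?f t)"
    by (rule suminf_mono_reindex) (auto simp: strict_mono_def image_iff dest: le_Suc_ex)
  finally show ?thesis by (simp add: passage_reward_def)
qed

lemma measurable_passage_reward [measurable]:
  "passage_reward G n k \<in> borel_measurable (PiM UNIV (stage_space G))"
proof -
  have [measurable]: "(\<lambda>\<omega>. g (\<omega> t)) \<in> measurable (PiM UNIV (stage_space G)) (count_space UNIV)" for t and g :: "_ \<Rightarrow> bool"
    by (rule measurable_compose[OF measurable_component_singleton[of t]]) (auto simp: stage_space_def)
  have [measurable]: "(\<lambda>\<omega>. g (\<omega> t)) \<in> borel_measurable (PiM UNIV (stage_space G))" for t and g :: "_ \<Rightarrow> ereal"
    by (rule measurable_compose[OF measurable_component_singleton[of t]]) (auto simp: stage_space_def)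
  have [measurable]: "Measurable.pred (PiM UNIV (stage_space G)) (\<lambda>\<omega>. state_at \<omega> t \<notin> target G)" for t
    by measurable
  have [measurable]: "(\<lambda>\<omega>. ereal (of_rat (reward G t k (state_at \<omega> t) (acts_at \<omega> t))))
      \<in> borel_measurable (PiM UNIV (stage_space G))" for t
    by measurable
  show ?thesis
    unfolding passage_reward_def less_passage_time_iff by measurable
qed

lemma initial_distribution_return: "i \<in> states G 0 \<Longrightarrow> initial_distribution G (return_pmf (i, \<mu>))"
  by (simp add: initial_distribution_def)

lemma stage_pmf_shift:
  assumes "0 < t" and \<omega>: "\<And>s. \<omega> (n + s) = y s"
  shows "stage_pmf G \<gamma> (of_markov \<phi>) (n + t) \<omega> =
         stage_pmf (shift_game n G) \<gamma>' (of_markov (\<lambda>l t. \<phi> l (n + t))) t y"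
proof -
  from \<open>0 < t\<close> obtain t' where t: "t = Suc t'" by (cases t) auto
  have "state_goals_pmf G \<gamma> (n + t) \<omega> = state_goals_pmf (shift_game n G) \<gamma>' t y"
    using \<omega>[of t'] by (simp add: t state_goals_pmf_def next_goals_def)
  then show ?thesis
    by (simp add: stage_pmf_def joint_action_pmf_def of_markov_def)
qed

lemma prod_lessThan_add:
  fixes f :: "nat \<Rightarrow> real"
  shows "(\<Prod>t<n + p. f t) = (\<Prod>t<n. f t) * (\<Prod>t<p. f (n + t))"
  by (induction p) (simp_all add: mult.assoc)

lemma markov_property:
  fixes G :: "('s, 'k::finite, 'a) game" and \<mu> :: "'k goals"
  assumes gm: "game_model G" and \<gamma>: "initial_distribution G \<gamma>"
    and \<phi>: "\<phi> \<in> markov_multipolicies G" and i: "i \<in> states G n"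
    and S: "S \<in> sets (PiM UNIV (stage_space (shift_game n G)))"
  defines "P \<equiv> law G \<gamma> (of_markov \<phi>)"
    and "P' \<equiv> law (shift_game n G) (return_pmf (i, \<mu>)) (of_markov (\<lambda>l t. \<phi> l (n + t)))"
    and "B \<equiv> {\<omega> \<in> PiE UNIV (stages G). state_at \<omega> n = i \<and> goals_at \<omega> n = \<mu>}"
  shows "emeasure P {\<omega> \<in> B. (\<lambda>t. \<omega> (n + t)) \<in> S} = emeasure P B * emeasure P' S"
    and "B \<in> sets P" and "{\<omega> \<in> B. (\<lambda>t. \<omega> (n + t)) \<in> S} \<in> sets P"
proof -
  let ?G = "shift_game n G" and ?\<pi> = "of_markov \<phi>"
  let ?\<pi>' = "of_markov (\<lambda>l t. \<phi> l (n + t))" and ?\<gamma> = "return_pmf (i, \<mu>)"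
  let ?\<theta> = "\<lambda>(\<omega> :: ('s, 'k, 'a) trajectory) t. \<omega> (n + t)"
  have gm': "game_model ?G" using gm by (rule game_model_shift)
  have \<gamma>': "initial_distribution ?G ?\<gamma>" using i by (simp add: initial_distribution_return)
  have \<pi>: "?\<pi> \<in> multipolicies G" "?\<pi>' \<in> multipolicies ?G"
    using \<phi> by (auto intro: of_markov_multipolicies markov_multipolicies_shift)
  note sets_P = sets_law[OF gm \<gamma> \<pi>(1), folded P_def]
  note sets_P' = sets_law[OF gm' \<gamma>' \<pi>(2), folded P'_def]
  note space_P = space_law[OF gm \<gamma> \<pi>(1), folded P_def]
  note space_P' = space_law[OF gm' \<gamma>' \<pi>(2), folded P'_def]
  interpret P: prob_space P unfolding P_def by (rule prob_space_law[OF gm \<gamma> \<pi>(1)])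
  interpret P': prob_space P' unfolding P'_def by (rule prob_space_law[OF gm' \<gamma>' \<pi>(2)])

  have "B = {\<omega> \<in> space (PiM UNIV (stage_space G)). \<omega> n \<in> {s \<in> stages G n. fst s = i \<and> fst (snd s) = \<mu>}}"
    by (auto simp: B_def space_PiM_stage_space PiE_iff)
  also have "\<dots> \<in> sets (PiM UNIV (stage_space G))"
    by (intro sets_Collect_single) (auto simp: stage_space_def)
  finally show B: "B \<in> sets P" unfolding sets_P .
  have \<theta>: "?\<theta> \<in> measurable P (PiM UNIV (stage_space ?G))"
    unfolding measurable_cong_sets[OF sets_P refl]
  proof (rule measurable_PiM_single')
    show "(\<lambda>\<omega>. \<omega> (n + t)) \<in> measurable (PiM UNIV (stage_space G)) (stage_space ?G t)" for t
      unfolding stage_space_shift by (rule measurable_component_singleton) simp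
  qed (auto simp: space_PiM_stage_space stages_shift space_PiM stage_space_def)
  have pre: "{\<omega> \<in> B. ?\<theta> \<omega> \<in> A} = B \<inter> (?\<theta> -` A \<inter> space P)" for A
    by (auto simp: B_def space_P)
  show in_P: "{\<omega> \<in> B. ?\<theta> \<omega> \<in> S} \<in> sets P"
    unfolding pre using B measurable_sets[OF \<theta> S] by auto

  define Q where "Q = distr (density P (indicator B)) (PiM UNIV (stage_space ?G)) ?\<theta>"
  have \<theta>': "?\<theta> \<in> measurable (density P (indicator B)) (PiM UNIV (stage_space ?G))"
    using \<theta> by simp
  have Q: "emeasure Q A = emeasure P {\<omega> \<in> B. ?\<theta> \<omega> \<in> A}"
    if A: "A \<in> sets (PiM UNIV (stage_space ?G))" for A
  proof -
    have "emeasure Q A = emeasure (density P (indicator B)) (?\<theta> -` A \<inter> space P)"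
      unfolding Q_def using emeasure_distr[OF \<theta>' A] by simp
    also have "\<dots> = (\<integral>\<^sup>+x. indicator B x * indicator (?\<theta> -` A \<inter> space P) x \<partial>P)"
      using B measurable_sets[OF \<theta> A] by (intro emeasure_density) auto
    also have "\<dots> = (\<integral>\<^sup>+x. indicator {\<omega> \<in> B. ?\<theta> \<omega> \<in> A} x \<partial>P)"
      unfolding pre by (intro nn_integral_cong) (auto split: split_indicator)
    also have "\<dots> = emeasure P {\<omega> \<in> B. ?\<theta> \<omega> \<in> A}"
      unfolding pre using B measurable_sets[OF \<theta> A] by (intro nn_integral_indicator) auto
    finally show ?thesis .
  qed

  define H where "H = PiE {0..<n} (stages G)"
  have countable_H: "countable H"
    unfolding H_def using countable_stages[OF gm] by (intro countable_PiE) auto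
  define K where "K h = (\<Prod>t<n. pmf (stage_pmf G \<gamma> ?\<pi> t h) (h t)) * pmf (state_goals_pmf G \<gamma> n h) (i, \<mu>)" for h
  define c where "c = (\<integral>\<^sup>+h. ennreal (K h) \<partial>count_space H)"

  have cyl: "emeasure P {\<omega> \<in> B. ?\<theta> \<omega> \<in> cyl ?G (Suc m) y} = c * emeasure P' (cyl ?G (Suc m) y)"
    if y: "\<And>t. y t \<in> stages ?G t" for m y
  proof -
    obtain j \<nu> a where y0: "y 0 = (j, \<nu>, a)" by (cases "y 0")
    have P'_cyl: "emeasure P' (cyl ?G (Suc m) y) = ennreal (\<Prod>t<Suc m. pmf (stage_pmf ?G ?\<gamma> ?\<pi>' t y) (y t))"
      unfolding P'_def using y by (intro emeasure_law_cyl[OF gm' \<gamma>' \<pi>(2)])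
    have first: "pmf (stage_pmf ?G ?\<gamma> ?\<pi>' 0 y) (y 0) =
        (if (j, \<nu>) = (i, \<mu>) then pmf (joint_action_pmf ?\<pi>' 0 ([], i, \<mu>)) a else 0)"
      by (auto simp: y0 pmf_stage_pmf state_goals_pmf_def)
    show ?thesis
    proof (cases "(j, \<nu>) = (i, \<mu>)")
      case False
      then have "{\<omega> \<in> B. ?\<theta> \<omega> \<in> cyl ?G (Suc m) y} = {}"
        using y0 by (auto simp: B_def cyl_def dest!: spec[of _ 0])
      moreover have "emeasure P' (cyl ?G (Suc m) y) = 0"
        unfolding P'_cyl using False first by (auto simp: prod.lessThan_Suc_shift simp del: prod.lessThan_Suc)
      ultimately show ?thesis by (simp only: emeasure_empty mult_zero_right)
    next
      case True
      define z where "z h t = (if t < n then h t else y (t - n))" for h :: "('s, 'k, 'a) trajectory" and t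
      have z_shift: "z h (n + t) = y t" for h t by (simp add: z_def)
      have z_in: "z h t \<in> stages G t" if "h \<in> H" for h t
        using that y[of "t - n"] by (auto simp: z_def H_def PiE_iff stages_shift)
      have "{\<omega> \<in> B. ?\<theta> \<omega> \<in> cyl ?G (Suc m) y} = (\<Union>h\<in>H. cyl G (n + Suc m) (z h))"
      proof (intro equalityI subsetI)
        fix \<omega> assume \<omega>: "\<omega> \<in> {\<omega> \<in> B. ?\<theta> \<omega> \<in> cyl ?G (Suc m) y}"
        then have "\<omega> \<in> PiE UNIV (stages G)" by (simp add: B_def)
        moreover from this have "restrict \<omega> {0..<n} \<in> H" by (auto simp: H_def PiE_iff)
        moreover have "\<omega> t = z (restrict \<omega> {0..<n}) t" if t: "t < n + Suc m" for t
        proof (cases "t < n")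
          case False
          then have "t - n < Suc m" using t by simp
          with \<omega> have "\<omega> (n + (t - n)) = y (t - n)" unfolding cyl_def by blast
          with False show ?thesis by (simp add: z_def)
        qed (simp add: z_def)
        ultimately show "\<omega> \<in> (\<Union>h\<in>H. cyl G (n + Suc m) (z h))"
          unfolding cyl_def by blast
      next
        fix \<omega> assume "\<omega> \<in> (\<Union>h\<in>H. cyl G (n + Suc m) (z h))"
        then obtain h where h: "h \<in> H" "\<omega> \<in> PiE UNIV (stages G)" "\<And>t. t < n + Suc m \<Longrightarrow> \<omega> t = z h t"
          by (auto simp: cyl_def)
        have \<omega>_shift: "\<omega> (n + t) = y t" if "t < Suc m" for t
          using h(3)[of "n + t"] that by (simp add: z_shift)
        moreover have "?\<theta> \<omega> \<in> PiE UNIV (stages ?G)"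
          using h(2) by (auto simp: PiE_iff stages_shift)
        moreover have "\<omega> \<in> B"
          using h(2) \<omega>_shift[of 0] y0 True by (auto simp: B_def)
        ultimately show "\<omega> \<in> {\<omega> \<in> B. ?\<theta> \<omega> \<in> cyl ?G (Suc m) y}"
          by (simp add: cyl_def)
      qed
      also have "emeasure P (\<Union>h\<in>H. cyl G (n + Suc m) (z h)) =
          (\<integral>\<^sup>+h. emeasure P (cyl G (n + Suc m) (z h)) \<partial>count_space H)"
      proof (rule emeasure_UN_countable[OF _ countable_H])
        show "cyl G (n + Suc m) (z h) \<in> sets P" if "h \<in> H" for h
          unfolding sets_P using z_in[OF that] by (intro cyl_in_sets)
        show "disjoint_family_on (\<lambda>h. cyl G (n + Suc m) (z h)) H"
        unfolding disjoint_family_on_def proof (intro ballI impI equals0I)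
          fix h h' \<omega> assume h: "h \<in> H" "h' \<in> H" "h \<noteq> h'"
            and \<omega>: "\<omega> \<in> cyl G (n + Suc m) (z h) \<inter> cyl G (n + Suc m) (z h')"
          have "h t = h' t" if "t < n" for t
          proof -
            have "\<omega> t = z h t" "\<omega> t = z h' t" using \<omega> that by (auto simp: cyl_def)
            with that show ?thesis by (simp add: z_def)
          qed
          then have "h = h'" using h(1,2) unfolding H_def by (intro PiE_ext) auto
          with h(3) show False by simp
        qed
      qed
      also have "\<dots> = (\<integral>\<^sup>+h. ennreal (K h) * emeasure P' (cyl ?G (Suc m) y) \<partial>count_space H)"
      proof (intro nn_integral_cong)
        fix h assume "h \<in> space (count_space H)"
        then have h: "h \<in> H" by simp
        have "emeasure P (cyl G (n + Suc m) (z h)) =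
            ennreal (\<Prod>t<n + Suc m. pmf (stage_pmf G \<gamma> ?\<pi> t (z h)) (z h t))"
          unfolding P_def using z_in[OF h] by (intro emeasure_law_cyl[OF gm \<gamma> \<pi>(1)])
        also have "(\<Prod>t<n + Suc m. pmf (stage_pmf G \<gamma> ?\<pi> t (z h)) (z h t)) =
            (\<Prod>t<n. pmf (stage_pmf G \<gamma> ?\<pi> t (z h)) (z h t)) *
            (\<Prod>t<Suc m. pmf (stage_pmf G \<gamma> ?\<pi> (n + t) (z h)) (z h (n + t)))"
          by (rule prod_lessThan_add)
        also have "(\<Prod>t<n. pmf (stage_pmf G \<gamma> ?\<pi> t (z h)) (z h t)) = (\<Prod>t<n. pmf (stage_pmf G \<gamma> ?\<pi> t h) (h t))"
        proof (intro prod.cong refl)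
          fix t assume t: "t \<in> {..<n}"
          have "stage_pmf G \<gamma> ?\<pi> t (z h) = stage_pmf G \<gamma> ?\<pi> t h"
            using t by (intro stage_pmf_cong) (auto simp: z_def)
          with t show "pmf (stage_pmf G \<gamma> ?\<pi> t (z h)) (z h t) = pmf (stage_pmf G \<gamma> ?\<pi> t h) (h t)"
            by (simp add: z_def)
        qed
        also have "(\<Prod>t<Suc m. pmf (stage_pmf G \<gamma> ?\<pi> (n + t) (z h)) (z h (n + t))) =
            pmf (stage_pmf G \<gamma> ?\<pi> n (z h)) (y 0) *
            (\<Prod>t<m. pmf (stage_pmf ?G ?\<gamma> ?\<pi>' (Suc t) y) (y (Suc t)))"
        proof -
          have "stage_pmf G \<gamma> ?\<pi> (n + Suc t) (z h) = stage_pmf ?G ?\<gamma> ?\<pi>' (Suc t) y" for t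
            by (rule stage_pmf_shift) (simp_all add: z_shift)
          then show ?thesis
            unfolding prod.lessThan_Suc_shift using z_shift[of h 0] by (simp only: z_shift add_0_right)
        qed
        also have "pmf (stage_pmf G \<gamma> ?\<pi> n (z h)) (y 0) =
            pmf (state_goals_pmf G \<gamma> n h) (i, \<mu>) * pmf (stage_pmf ?G ?\<gamma> ?\<pi>' 0 y) (y 0)"
        proof -
          have "stage_pmf G \<gamma> ?\<pi> n (z h) = stage_pmf G \<gamma> ?\<pi> n h"
            by (rule stage_pmf_cong) (simp add: z_def)
          moreover have "joint_action_pmf ?\<pi> n (map h [0..<n], i, \<mu>) = joint_action_pmf ?\<pi>' 0 ([], i, \<mu>)"
            by (simp add: joint_action_pmf_def of_markov_def)
          ultimately show ?thesis
            unfolding first using True by (simp add: y0 pmf_stage_pmf)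
        qed
        finally show "emeasure P (cyl G (n + Suc m) (z h)) = ennreal (K h) * emeasure P' (cyl ?G (Suc m) y)"
          unfolding P'_cyl K_def prod.lessThan_Suc_shift
          by (simp add: ennreal_mult[symmetric] prod_nonneg mult.assoc del: prod.lessThan_Suc)
      qed
      also have "\<dots> = c * emeasure P' (cyl ?G (Suc m) y)"
        unfolding c_def by (rule nn_integral_multc) simp
      finally show ?thesis .
    qed
  qed

  obtain y0 where y0: "y0 \<in> PiE UNIV (stages ?G)"
    using P'.not_empty space_P' by auto
  have y0': "y0 t \<in> stages ?G t" for t using y0 by (auto simp: PiE_iff)
  define E where "E = {cyl ?G (Suc m) y |m y. \<forall>t. y t \<in> stages ?G t} \<union> {{}}"
  note sets_E = sets_PiM_stage_space_cyl[OF gm' y0', folded E_def]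
  have Q_eq: "Q = scale_measure c P'"
  proof (rule measure_eqI_generator_eq_countable[where E=E and A="(\<lambda>s. cyl ?G 1 (y0(0 := s))) ` stages ?G 0"])
    show "Int_stable E" unfolding E_def by (rule Int_stable_cyl)
    show "E \<subseteq> Pow (PiE UNIV (stages ?G))" by (auto simp: E_def cyl_def)
    show "sets Q = sigma_sets (PiE UNIV (stages ?G)) E" by (simp add: Q_def sets_E)
    show "sets (scale_measure c P') = sigma_sets (PiE UNIV (stages ?G)) E"
      by (simp add: sets_P' sets_E)
    show "emeasure Q X = emeasure (scale_measure c P') X" if "X \<in> E" for X
    proof (cases "X = {}")
      case False
      with that obtain m y where X: "X = cyl ?G (Suc m) y" and y: "\<And>t. y t \<in> stages ?G t"
        unfolding E_def by blast
      have "X \<in> sets (PiM UNIV (stage_space ?G))" unfolding X using y by (intro cyl_in_sets)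
      from Q[OF this] cyl[OF y] show ?thesis by (simp add: X)
    qed simp
    show "(\<lambda>s. cyl ?G 1 (y0(0 := s))) ` stages ?G 0 \<subseteq> E"
    proof (rule image_subsetI)
      fix s assume "s \<in> stages ?G 0"
      then have "\<forall>t. (y0(0 := s)) t \<in> stages ?G t" using y0' by simp
      then show "cyl ?G 1 (y0(0 := s)) \<in> E" unfolding E_def One_nat_def by blast
    qed
    show "\<Union>((\<lambda>s. cyl ?G 1 (y0(0 := s))) ` stages ?G 0) = PiE UNIV (stages ?G)"
      by (auto simp: cyl_def PiE_iff)
    show "countable ((\<lambda>s. cyl ?G 1 (y0(0 := s))) ` stages ?G 0)"
      using countable_stages[OF gm'] by simp
    show "emeasure Q X \<noteq> \<infinity>" if "X \<in> (\<lambda>s. cyl ?G 1 (y0(0 := s))) ` stages ?G 0" for X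
    proof -
      from that obtain s where s: "s \<in> stages ?G 0" "X = cyl ?G 1 (y0(0 := s))" by blast
      then have "X \<in> sets (PiM UNIV (stage_space ?G))"
        using y0' by (auto intro!: cyl_in_sets)
      then show ?thesis by (simp add: Q P.emeasure_eq_measure)
    qed
  qed
  have "emeasure P B = emeasure Q (space P')"
  proof -
    have "space P' \<in> sets (PiM UNIV (stage_space ?G))" using sets_P' by auto
    from Q[OF this] have "emeasure Q (space P') = emeasure P {\<omega> \<in> B. ?\<theta> \<omega> \<in> space P'}" .
    also have "{\<omega> \<in> B. ?\<theta> \<omega> \<in> space P'} = B"
      by (auto simp: B_def space_P' PiE_iff stages_shift)
    finally show ?thesis by simp
  qed
  then have "emeasure P B = c" by (simp add: Q_eq P'.emeasure_space_1)
  with Q[OF S] show "emeasure P {\<omega> \<in> B. ?\<theta> \<omega> \<in> S} = emeasure P B * emeasure P' S"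
    by (simp add: Q_eq)
qed

theorem F_eq_cond_prob:
  fixes G :: "('s, 'k::finite, 'a) game"
  assumes gm: "game_model G" and \<gamma>: "initial_distribution G \<gamma>"
    and \<phi>: "\<phi> \<in> markov_multipolicies G"
    and pos: "0 < \<P>(\<omega> in law G \<gamma> (of_markov \<phi>). state_at \<omega> n = i \<and> goals_at \<omega> n = \<mu>)"
  shows "F G \<phi> n k i \<mu> =
    \<P>(\<omega> in law G \<gamma> (of_markov \<phi>).
        ereal (of_rat (\<mu> k)) \<le> passage_reward G n k \<omega> \<bar> state_at \<omega> n = i \<and> goals_at \<omega> n = \<mu>)"
proof -
  let ?G = "shift_game n G" and ?P = "law G \<gamma> (of_markov \<phi>)"
  let ?P' = "law ?G (return_pmf (i, \<mu>)) (of_markov (\<lambda>l t. \<phi> l (n + t)))"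
  let ?B = "{\<omega> \<in> PiE UNIV (stages G). state_at \<omega> n = i \<and> goals_at \<omega> n = \<mu>}"
  let ?S = "{\<omega> \<in> PiE UNIV (stages ?G). ereal (of_rat (\<mu> k)) \<le> passage_reward ?G 0 k \<omega>}"
  note space_P = space_law[OF gm \<gamma> of_markov_multipolicies[OF \<phi>]]
  have "?B \<noteq> {}" using pos unfolding space_P by (metis (lifting) less_irrefl measure_empty)
  then obtain \<omega> where "\<omega> \<in> PiE UNIV (stages G)" "state_at \<omega> n = i" by blast
  then have i: "i \<in> states G n" by (auto simp: PiE_iff stages_def dest!: spec[of _ n])
  have "?S = {\<omega> \<in> space (PiM UNIV (stage_space ?G)). ereal (of_rat (\<mu> k)) \<le> passage_reward ?G 0 k \<omega>}"
    by (simp add: space_PiM_stage_space)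
  also have "\<dots> \<in> sets (PiM UNIV (stage_space ?G))" by measurable
  finally have S: "?S \<in> sets (PiM UNIV (stage_space ?G))" .
  have space_P': "space ?P' = PiE UNIV (stages ?G)"
    using i by (intro space_law game_model_shift gm initial_distribution_return
        of_markov_multipolicies markov_multipolicies_shift \<phi>) simp
  have "{\<omega> \<in> ?B. (\<lambda>t. \<omega> (n + t)) \<in> ?S} =
      {\<omega> \<in> space ?P. ereal (of_rat (\<mu> k)) \<le> passage_reward G n k \<omega> \<and> state_at \<omega> n = i \<and> goals_at \<omega> n = \<mu>}"
    by (auto simp: space_P passage_reward_shift[of G n] PiE_iff stages_shift)
  moreover have "measure ?P {\<omega> \<in> ?B. (\<lambda>t. \<omega> (n + t)) \<in> ?S} = measure ?P ?B * measure ?P' ?S"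
    using markov_property(1)[OF gm \<gamma> \<phi> i S, of \<mu>] by (simp add: measure_def enn2real_mult)
  ultimately show ?thesis
    using pos unfolding F_def F0_def cond_prob_def space_P space_P' by simp
qed

lemma F_0: "F G \<phi> 0 = F0 G (of_markov \<phi>)"
  by (intro ext, cases G) (simp add: F_def shift_game_def)

end

theory Submission
  imports Defs
begin

text \<open>
  The theorem is an optional stopping argument. When the target is reached nothing more is
  collected, and since the goals are lowered by every reward received, the original goal of
  player \<open>k\<close> has been met by then exactly when the current one is at most zero. So extend the
  functions \<open>u\<^sub>n\<close> to the target by the indicator of a nonpositive goal (\<open>with_boundary\<close>). With these
  boundary values \<open>T\<close> is simply the expectation of the value one step later
  (\<open>T_mixed_eq_nn_integral\<close>), and \<open>u\<^sub>n \<le> T u\<^bsub>n+1\<^esub>\<close> says that the value of the history, frozen at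
  the first visit to the target (\<open>stopped_value\<close>), is a submartingale; with \<open>\<ge>\<close> it is a
  supermartingale. Its expectation starts at \<open>u\<^sub>0(i, \<lambda>)\<close> and is monotone in time. If the target is
  reached almost surely, the stopped value is eventually equal to the indicator that the goal is
  met. As it is bounded by one, its expectations converge to \<open>F\<^sub>0(i, \<lambda>)\<close>
  (\<open>expected_stopped_value_tendsto\<close>), and part (a) follows with both inequalities. All expectations
  of a function of the history at time \<open>n\<close> are taken under an explicit discrete law, which
  \<open>distr_history_at\<close> identifies with the law of the history under the Ionescu-Tulcea measure.

  Part (b) is the same argument for the game with its time origin moved to \<open>n\<close>. What has to be shown
  is that the target is reached almost surely there, whereas Assumption A speaks of histories of the
  original game that have positive probability. For an attainable state such a history, ending with
  any given goals, is produced by playing suitable pure actions before time \<open>n\<close> and the given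
  policy afterwards (\<open>attainable_reached\<close>); the Markov property carries the conclusion over to the
  shifted process (\<open>AE_passage_time_shift\<close>).

  For part (c), the Markov property at time 1 shows that \<open>F\<^sub>0\<close> is the expectation of \<open>F\<^sub>1\<close> at the next
  state and goals (\<open>F0_first_step\<close>). As \<open>F\<^sub>1\<close> has the boundary values above on the target, this is
  the equation \<open>F\<^sub>0 = T F\<^sub>1\<close>, and shifting the origin gives it for all \<open>n\<close>. Uniqueness is part (b)
  applied with both inequalities.
\<close>

section \<open>The law of the history\<close>

lemma finite_joint_acts:
  assumes "game_model G" "i \<in> states G n" shows "finite (joint_acts G n i)"
proof -
  have "joint_acts G n i = PiE UNIV (\<lambda>k. acts G n k i)"
    by (auto simp: joint_acts_def)
  with assms show ?thesis by (auto simp: game_model_def intro!: finite_PiE)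
qed

lemma cur_state_histories: "h \<in> histories G n \<Longrightarrow> cur_state h \<in> states G n"
  by (cases h) (auto simp: histories_eq)

text \<open>
  If the outcome determines both stages of a two-stage experiment, its probability is a single
  product and no sum over intermediate results remains.
\<close>

lemma pmf_bind_map_tagged:
  assumes inj: "\<And>x y x' y'. c x y = c x' y' \<Longrightarrow> x = x' \<and> y = y'"
  shows "pmf (bind_pmf p (\<lambda>x. map_pmf (c x) (q x))) (c x y) = pmf p x * pmf (q x) y"
proof -
  have "ennreal (pmf (bind_pmf p (\<lambda>x. map_pmf (c x) (q x))) (c x y)) =
      (\<integral>\<^sup>+x'. ennreal (pmf (q x) y) * indicator {x} x' \<partial>p)"
    unfolding ennreal_pmf_bind
  proof (intro nn_integral_cong)
    fix x'
    have "pmf (map_pmf (c x) (q x)) (c x y) = pmf (q x) y"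
      using inj by (intro pmf_map_inj') (auto simp: inj_def)
    moreover have "pmf (map_pmf (c x') (q x')) (c x y) = 0" if "x' \<noteq> x"
      using inj that by (auto simp: pmf_eq_0_set_pmf)
    ultimately show "ennreal (pmf (map_pmf (c x') (q x')) (c x y)) = ennreal (pmf (q x) y) * indicator {x} x'"
      by (cases "x' = x") auto
  qed
  also have "\<dots> = ennreal (pmf p x * pmf (q x) y)"
    by (subst nn_integral_cmult_indicator)
       (auto simp: emeasure_pmf_single ennreal_mult' mult.commute)
  finally show ?thesis by (simp add: ennreal_inj)
qed

definition next_history ::
    "('s, 'k, 'a) game \<Rightarrow> nat \<Rightarrow> ('s, 'k, 'a) history \<Rightarrow> ('k \<Rightarrow> 'a) \<Rightarrow> 's \<Rightarrow> ('s, 'k, 'a) history" where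
  "next_history G n h a j =
     (fst h @ [(cur_state h, cur_goals h, a)], j, next_goals G n (cur_state h) (cur_goals h) a)"

text \<open>
  Here a step first draws the actions and then the next state, whereas a stage of the process
  consists of a state followed by the actions chosen there. This is the grouping in which the
  operator \<open>T\<close> acts on a history.
\<close>

primrec history_pmf ::
    "('s, 'k::finite, 'a) game \<Rightarrow> ('s \<times> 'k goals) pmf \<Rightarrow> ('k \<Rightarrow> ('s, 'k, 'a) policy)
       \<Rightarrow> nat \<Rightarrow> ('s, 'k, 'a) history pmf" where
  "history_pmf G \<gamma> \<pi> 0 = map_pmf (Pair []) \<gamma>"
| "history_pmf G \<gamma> \<pi> (Suc n) =
     bind_pmf (history_pmf G \<gamma> \<pi> n) (\<lambda>h. bind_pmf (joint_action_pmf \<pi> n h) (\<lambda>a.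
       map_pmf (next_history G n h a) (transition G n (cur_state h) a)))"

lemma pmf_history_pmf:
  "pmf (history_pmf G \<gamma> \<pi> n) (map x [0..<n], i, \<mu>) =
     (\<Prod>t<n. pmf (stage_pmf G \<gamma> \<pi> t x) (x t)) * pmf (state_goals_pmf G \<gamma> n x) (i, \<mu>)"
proof (induction n arbitrary: i \<mu>)
  case 0
  have "pmf (map_pmf (Pair ([] :: ('a, 'b, 'c) stage list)) \<gamma>) ([], i, \<mu>) = pmf \<gamma> (i, \<mu>)"
    by (intro pmf_map_inj') (simp add: inj_def)
  then show ?case by (simp add: state_goals_pmf_def)
next
  case (Suc n)
  obtain j \<nu> a where xn: "x n = (j, \<nu>, a)" by (cases "x n")
  let ?h = "(map x [0..<n], j, \<nu>)"
  \<comment> \<open>Draw the history up to \<open>n\<close>, the actions and the next state in turn; \<open>c\<close> glues them together without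
    loss of information, so the probabilities multiply.\<close>
  define c where "c = (\<lambda>(h, a) (j, \<nu>). (fst h @ [(cur_state h, cur_goals h, a)], j, \<nu>) :: ('a, 'b, 'c) history)"
  have "history_pmf G \<gamma> \<pi> (Suc n) =
      bind_pmf (bind_pmf (history_pmf G \<gamma> \<pi> n) (\<lambda>h. map_pmf (Pair h) (joint_action_pmf \<pi> n h)))
        (\<lambda>(h, a). map_pmf (c (h, a))
           (map_pmf (\<lambda>j. (j, next_goals G n (cur_state h) (cur_goals h) a)) (transition G n (cur_state h) a)))"
    by (simp add: bind_assoc_pmf bind_map_pmf map_pmf_comp next_history_def[abs_def] c_def)
  also have "\<dots> = bind_pmf (bind_pmf (history_pmf G \<gamma> \<pi> n) (\<lambda>h. map_pmf (Pair h) (joint_action_pmf \<pi> n h)))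
        (\<lambda>p. map_pmf (c p)
           (map_pmf (\<lambda>j. (j, next_goals G n (cur_state (fst p)) (cur_goals (fst p)) (snd p)))
              (transition G n (cur_state (fst p)) (snd p))))"
    by (simp add: case_prod_beta')
  also have "pmf \<dots> (c (?h, a) (i, \<mu>)) =
      pmf (history_pmf G \<gamma> \<pi> n) ?h * pmf (joint_action_pmf \<pi> n ?h) a *
      pmf (map_pmf (\<lambda>j'. (j', next_goals G n j \<nu> a)) (transition G n j a)) (i, \<mu>)"
    by (subst pmf_bind_map_tagged, force simp: c_def, subst pmf_bind_map_tagged) auto
  also have "c (?h, a) (i, \<mu>) = (map x [0..<Suc n], i, \<mu>)"
    by (simp add: c_def xn)
  also have "map_pmf (\<lambda>j'. (j', next_goals G n j \<nu> a)) (transition G n j a) = state_goals_pmf G \<gamma> (Suc n) x"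
    by (simp add: state_goals_pmf_def xn)
  finally show ?case
    by (simp add: Suc.IH xn pmf_stage_pmf mult.assoc)
qed

lemma set_history_pmf:
  assumes "game_model G" "initial_distribution G \<gamma>" "\<pi> \<in> multipolicies G"
  shows "set_pmf (history_pmf G \<gamma> \<pi> n) \<subseteq> histories G n"
proof (induction n)
  case 0
  show ?case using assms(2) by (auto simp: initial_distribution_def)
next
  case (Suc n)
  show ?case
  proof
    fix h' assume "h' \<in> set_pmf (history_pmf G \<gamma> \<pi> (Suc n))"
    then obtain h a j where h: "h \<in> set_pmf (history_pmf G \<gamma> \<pi> n)" "a \<in> set_pmf (joint_action_pmf \<pi> n h)"
      "j \<in> set_pmf (transition G n (cur_state h) a)" "h' = next_history G n h a j"
      by auto
    obtain hs i \<mu> where [simp]: "h = (hs, i, \<mu>)" by (cases h)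
    have "h \<in> histories G n" using h(1) Suc by blast
    moreover from this have "a \<in> joint_acts G n i" "i \<in> states G n"
      using set_joint_action_pmf[OF assms(3)] h(2) by (fastforce simp: histories_eq)+
    moreover from this have "j \<in> states G (Suc n)"
      using assms(1) h(3) by (fastforce simp: game_model_def)
    ultimately show "h' \<in> histories G (Suc n)"
      by (auto simp: h(4) next_history_def)
  qed
qed

lemma countable_histories:
  assumes "game_model G" shows "countable (histories G n)"
proof -
  have "histories G n \<subseteq> (\<lambda>(x, i, \<mu>). (map x [0..<n], i, \<mu>)) ` (PiE {0..<n} (stages G) \<times> states G n \<times> UNIV)"
  proof
    fix h assume h: "h \<in> histories G n"
    obtain hs i \<mu> where [simp]: "h = (hs, i, \<mu>)" by (cases h)
    have hs: "length hs = n" "\<forall>t<n. hs ! t \<in> stages G t" "i \<in> states G n"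
      using h by (auto simp: histories_eq)
    have "hs = map (restrict ((!) hs) {0..<n}) [0..<n]"
      using hs(1) by (auto intro: nth_equalityI)
    moreover have "restrict ((!) hs) {0..<n} \<in> PiE {0..<n} (stages G)"
      using hs(2) by auto
    ultimately show "h \<in> (\<lambda>(x, i, \<mu>). (map x [0..<n], i, \<mu>)) ` (PiE {0..<n} (stages G) \<times> states G n \<times> UNIV)"
      using hs(3) by (intro image_eqI[of _ _ "(restrict ((!) hs) {0..<n}, i, \<mu>)"]) auto
  qed
  moreover have "countable (PiE {0..<n} (stages G) \<times> states G n \<times> (UNIV :: 'b goals set))"
    using assms by (intro countable_SIGMA countable_PiE countable_stages) (auto simp: game_model_def)
  ultimately show ?thesis by (rule countable_subset[OF _ countable_image])
qed

lemma measurable_history_at: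
  assumes "game_model G" "initial_distribution G \<gamma>" "\<pi> \<in> multipolicies G"
  shows "(\<lambda>\<omega>. history_at \<omega> n) \<in> measurable (law G \<gamma> \<pi>) (count_space UNIV)"
proof -
  have "(\<lambda>\<omega>. restrict \<omega> {0..<Suc n}) \<in> measurable (PiM UNIV (stage_space G)) (PiM {0..<Suc n} (stage_space G))"
    by (rule measurable_restrict_subset) simp
  then have "(\<lambda>\<omega>. restrict \<omega> {0..<Suc n}) \<in> measurable (PiM UNIV (stage_space G)) (count_space (PiE {0..<Suc n} (stages G)))"
    by (simp add: PiM_stage_space_finite[OF assms(1)])
  then have "(\<lambda>\<omega>. history_at (restrict \<omega> {0..<Suc n}) n) \<in> measurable (PiM UNIV (stage_space G)) (count_space UNIV)"
    by (rule measurable_compose) simp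
  also have "(\<lambda>\<omega>. history_at (restrict \<omega> {0..<Suc n}) n) = (\<lambda>\<omega>. history_at \<omega> n)"
    by (auto simp: history_at_def)
  finally show ?thesis
    unfolding measurable_cong_sets[OF sets_law[OF assms] refl] .
qed

lemma history_at_histories:
  "\<omega> \<in> PiE UNIV (stages G) \<Longrightarrow> history_at \<omega> n \<in> histories G n"
  by (auto simp: history_at_def histories_eq PiE_iff stages_def dest!: spec[of _ n])

text \<open>
  Both sides live on the countable set of histories, so it suffices to compare point masses. The
  event that the history is \<open>(hs, i, \<mu>)\<close> splits into cylinders according to the action taken at time
  \<open>n\<close>; their probabilities differ only in the factor for that action, and these factors sum to one.
\<close>

lemma distr_history_at:
  assumes gm: "game_model G" and \<gamma>: "initial_distribution G \<gamma>" and \<pi>: "\<pi> \<in> multipolicies G"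
  shows "distr (law G \<gamma> \<pi>) (count_space UNIV) (\<lambda>\<omega>. history_at \<omega> n) = measure_pmf (history_pmf G \<gamma> \<pi> n)"
proof (rule measure_eqI_countable_AE[where \<Omega> = "histories G n"])
  let ?P = "law G \<gamma> \<pi>"
  note m = measurable_history_at[OF assms, of n]
  note space_P = space_law[OF assms]
  have "AE \<omega> in ?P. history_at \<omega> n \<in> histories G n"
    by (rule AE_I2) (simp add: space_P history_at_histories)
  then show "AE h in distr ?P (count_space UNIV) (\<lambda>\<omega>. history_at \<omega> n). h \<in> histories G n"
    by (subst AE_distr_iff[OF m]) auto
  show "AE h in measure_pmf (history_pmf G \<gamma> \<pi> n). h \<in> histories G n"
    using set_history_pmf[OF assms] by (auto simp: AE_measure_pmf_iff)
  show "countable (histories G n)" by (rule countable_histories[OF gm])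
  fix h assume h: "h \<in> histories G n"
  obtain hs i \<mu> where h_eq: "h = (hs, i, \<mu>)" by (cases h)
  have hs: "length hs = n" "\<And>t. t < n \<Longrightarrow> hs ! t \<in> stages G t" and i: "i \<in> states G n"
    using h by (auto simp: h_eq histories_eq)
  let ?A = "joint_acts G n i"
  define x where "x a t = (if t < n then hs ! t else (i, \<mu>, a))" for a t
  have x_in: "x a t \<in> stages G t" if "a \<in> ?A" "t < Suc n" for a t
    using that hs(2) i by (cases "t < n") (auto simp: x_def stages_def less_Suc_eq)
  have map_x: "map (x a) [0..<n] = hs" for a
    using hs(1) by (auto simp: x_def intro: nth_equalityI)
  note fin = finite_joint_acts[OF gm i]
  have "emeasure (distr ?P (count_space UNIV) (\<lambda>\<omega>. history_at \<omega> n)) {h} =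
      emeasure ?P {\<omega> \<in> PiE UNIV (stages G). history_at \<omega> n = h}"
    by (subst emeasure_distr[OF m]) (auto simp: space_P intro!: arg_cong[where f = "emeasure ?P"])
  also have "{\<omega> \<in> PiE UNIV (stages G). history_at \<omega> n = h} = (\<Union>a\<in>?A. cyl G (Suc n) (x a))"
  proof (intro equalityI subsetI)
    fix \<omega> assume \<omega>: "\<omega> \<in> {\<omega> \<in> PiE UNIV (stages G). history_at \<omega> n = h}"
    have "\<omega> n \<in> stages G n" using \<omega> by (auto simp: PiE_iff)
    then have "acts_at \<omega> n \<in> ?A"
      using \<omega> by (auto simp: stages_def history_at_def h_eq)
    moreover have "\<omega> t = x (acts_at \<omega> n) t" if "t < Suc n" for t
      using \<omega> that by (cases "t < n") (auto simp: history_at_def h_eq x_def less_Suc_eq intro!: prod_eqI)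
    ultimately show "\<omega> \<in> (\<Union>a\<in>?A. cyl G (Suc n) (x a))"
      using \<omega> unfolding cyl_def by blast
  next
    fix \<omega> assume "\<omega> \<in> (\<Union>a\<in>?A. cyl G (Suc n) (x a))"
    then obtain a where \<omega>: "\<omega> \<in> PiE UNIV (stages G)" "\<And>t. t < Suc n \<Longrightarrow> \<omega> t = x a t"
      by (auto simp: cyl_def)
    have "map \<omega> [0..<n] = hs" unfolding map_x[of a, symmetric] using \<omega>(2) by simp
    moreover have "\<omega> n = (i, \<mu>, a)" using \<omega>(2)[of n] by (simp add: x_def)
    ultimately show "\<omega> \<in> {\<omega> \<in> PiE UNIV (stages G). history_at \<omega> n = h}"
      using \<omega>(1) by (simp add: history_at_def h_eq)
  qed
  also have "emeasure ?P \<dots> = (\<Sum>a\<in>?A. emeasure ?P (cyl G (Suc n) (x a)))"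
  proof (rule sum_emeasure[symmetric])
    show "(\<lambda>a. cyl G (Suc n) (x a)) ` ?A \<subseteq> sets ?P"
      unfolding sets_law[OF assms] using x_in by (auto intro!: cyl_in_sets)
    show "disjoint_family_on (\<lambda>a. cyl G (Suc n) (x a)) ?A"
      by (auto simp: disjoint_family_on_def cyl_def x_def)
  qed (rule fin)
  also have "\<dots> = (\<Sum>a\<in>?A. ennreal (pmf (history_pmf G \<gamma> \<pi> n) h * pmf (joint_action_pmf \<pi> n h) a))"
  proof (intro sum.cong refl)
    fix a assume a: "a \<in> ?A"
    have "emeasure ?P (cyl G (Suc n) (x a)) = ennreal (\<Prod>t<Suc n. pmf (stage_pmf G \<gamma> \<pi> t (x a)) (x a t))"
      using x_in[OF a] by (intro emeasure_law_cyl[OF assms]) auto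
    also have "(\<Prod>t<Suc n. pmf (stage_pmf G \<gamma> \<pi> t (x a)) (x a t)) =
        pmf (history_pmf G \<gamma> \<pi> n) h * pmf (joint_action_pmf \<pi> n h) a"
    proof -
      have "x a n = (i, \<mu>, a)" by (simp add: x_def)
      then show ?thesis
        using pmf_history_pmf[of G \<gamma> \<pi> n "x a" i \<mu>] by (simp add: pmf_stage_pmf map_x h_eq)
    qed
    finally show "emeasure ?P (cyl G (Suc n) (x a)) =
        ennreal (pmf (history_pmf G \<gamma> \<pi> n) h * pmf (joint_action_pmf \<pi> n h) a)" .
  qed
  also have "\<dots> = ennreal (pmf (history_pmf G \<gamma> \<pi> n) h * (\<Sum>a\<in>?A. pmf (joint_action_pmf \<pi> n h) a))"
    by (subst sum_ennreal) (auto simp: sum_distrib_left)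
  also have "(\<Sum>a\<in>?A. pmf (joint_action_pmf \<pi> n h) a) = 1"
    using set_joint_action_pmf[OF \<pi> h] fin by (intro sum_pmf_eq_1) (auto simp: h_eq)
  finally show "emeasure (distr ?P (count_space UNIV) (\<lambda>\<omega>. history_at \<omega> n)) {h} =
      emeasure (measure_pmf (history_pmf G \<gamma> \<pi> n)) {h}"
    by (simp add: emeasure_pmf_single)
qed auto

lemma AE_history_at_iff:
  assumes "game_model G" "initial_distribution G \<gamma>" "\<pi> \<in> multipolicies G"
  shows "(AE \<omega> in law G \<gamma> \<pi>. Q (history_at \<omega> n)) \<longleftrightarrow> (\<forall>h\<in>set_pmf (history_pmf G \<gamma> \<pi> n). Q h)"
proof -
  have "(AE \<omega> in law G \<gamma> \<pi>. Q (history_at \<omega> n)) \<longleftrightarrow> (AE h in measure_pmf (history_pmf G \<gamma> \<pi> n). Q h)"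
    unfolding distr_history_at[OF assms, symmetric]
    by (subst AE_distr_iff[OF measurable_history_at[OF assms]]) auto
  then show ?thesis by (simp add: AE_measure_pmf_iff)
qed

lemma nn_integral_history_at:
  assumes "game_model G" "initial_distribution G \<gamma>" "\<pi> \<in> multipolicies G"
  shows "(\<integral>\<^sup>+\<omega>. f (history_at \<omega> n) \<partial>law G \<gamma> \<pi>) = (\<integral>\<^sup>+h. f h \<partial>history_pmf G \<gamma> \<pi> n)"
  unfolding distr_history_at[OF assms, symmetric]
  by (subst nn_integral_distr[OF measurable_history_at[OF assms]]) auto

lemma history_pmf_cong:
  assumes "\<And>l t. t < n \<Longrightarrow> \<pi> l t = \<pi>' l t"
  shows "history_pmf G \<gamma> \<pi> n = history_pmf G \<gamma> \<pi>' n"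
  using assms
proof (induction n)
  case (Suc n)
  have "joint_action_pmf \<pi> n = joint_action_pmf \<pi>' n"
    using Suc.prems by (simp add: joint_action_pmf_def[abs_def])
  moreover have "history_pmf G \<gamma> \<pi> n = history_pmf G \<gamma> \<pi>' n"
    using Suc by simp
  ultimately show ?case by simp
qed simp

section \<open>The operators as expectations\<close>

text \<open>
  Expectations are taken as integrals with values in \<open>ennreal\<close>, because iterating them over a
  \<open>bind_pmf\<close> then needs no integrability conditions; the infinite sums in \<open>T\<close> have to be brought
  into this form.
\<close>

lemma nn_integral_pmf_eq_infsum:
  assumes f: "\<And>j. j \<in> A \<Longrightarrow> 0 \<le> f j \<and> f j \<le> 1"
  shows "(\<integral>\<^sup>+j. ennreal (f j) * indicator A j \<partial>measure_pmf p) = ennreal (\<Sum>\<^sub>\<infinity>j\<in>A. f j * pmf p j)"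
proof -
  let ?g = "\<lambda>j. f j * pmf p j"
  have "Infinite_Set_Sum.abs_summable_on ?g A"
    by (rule abs_summable_on_comparison_test'[OF pmf_abs_summable[of p]])
      (use f in \<open>auto simp: abs_mult intro!: mult_left_le_one_le\<close>)
  then have "infsum ?g A = (\<integral>j. ?g j \<partial>count_space A)" and int: "integrable (count_space A) ?g"
    by (auto simp: infsetsum_infsum[symmetric] infsetsum_def abs_summable_on_def)
  then have "ennreal (infsum ?g A) = (\<integral>\<^sup>+j. ennreal (?g j) \<partial>count_space A)"
    using f by (subst nn_integral_eq_integral) (auto simp: AE_count_space)
  also have "\<dots> = (\<integral>\<^sup>+j. ennreal (?g j) * indicator A j \<partial>count_space UNIV)"
    by (simp add: nn_integral_count_space_indicator)
  also have "\<dots> = (\<integral>\<^sup>+j. ennreal (pmf p j) * (ennreal (f j) * indicator A j) \<partial>count_space UNIV)"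
    using f by (intro nn_integral_cong) (auto split: split_indicator simp: ennreal_mult mult.commute)
  finally show ?thesis by (simp add: nn_integral_measure_pmf)
qed

text \<open>
  In a target state nothing more is collected, so the goal counts as met there exactly when it is
  no longer positive. With these boundary values the two parts of the operator merge into one
  expectation over the next state.
\<close>

definition with_boundary ::
    "('s, 'k, 'a) game \<Rightarrow> 'k \<Rightarrow> ('s \<Rightarrow> 'k goals \<Rightarrow> real) \<Rightarrow> 's \<Rightarrow> 'k goals \<Rightarrow> real" where
  "with_boundary G k u j \<nu> = (if j \<in> target G then of_bool (\<nu> k \<le> 0) else u j \<nu>)"

lemma T_action_nonneg:
  assumes "u \<in> goal_functions G (Suc n) k"
  shows "0 \<le> T_action G n k a u i \<mu>"
  using assms unfolding T_action_def goal_functions_def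
  by (intro add_nonneg_nonneg mult_nonneg_nonneg infsum_nonneg) auto

lemma T_action_eq_nn_integral:
  assumes gm: "game_model G" and i: "i \<in> states G n" and a: "a \<in> joint_acts G n i"
    and u: "u \<in> goal_functions G (Suc n) k"
  shows "ennreal (T_action G n k a u i \<mu>) =
    (\<integral>\<^sup>+j. ennreal (with_boundary G k u j (next_goals G n i \<mu> a)) \<partial>transition G n i a)"
proof -
  let ?p = "transition G n i a" and ?\<nu> = "next_goals G n i \<mu> a" and ?D = "target G"
  let ?C = "states G (Suc n) - ?D" and ?c = "of_bool (?\<nu> k \<le> 0) :: real"
  have u': "0 \<le> u j ?\<nu> \<and> u j ?\<nu> \<le> 1" if "j \<in> ?C" for j
    using u that by (auto simp: goal_functions_def)
  have "set_pmf ?p \<subseteq> states G (Suc n)"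
    using gm i a by (auto simp: game_model_def)
  then have "(\<integral>\<^sup>+j. ennreal (with_boundary G k u j ?\<nu>) \<partial>?p) =
      (\<integral>\<^sup>+j. ennreal ?c * (ennreal 1 * indicator ?D j) + ennreal (u j ?\<nu>) * indicator ?C j \<partial>?p)"
    by (intro nn_integral_cong_AE) (auto simp: AE_measure_pmf_iff with_boundary_def split: split_indicator)
  also have "\<dots> = ennreal ?c * (\<integral>\<^sup>+j. ennreal 1 * indicator ?D j \<partial>?p) + (\<integral>\<^sup>+j. ennreal (u j ?\<nu>) * indicator ?C j \<partial>?p)"
    by (subst nn_integral_add, simp, simp, subst nn_integral_cmult, simp, rule refl)
  also have "\<dots> = ennreal ?c * ennreal (\<Sum>\<^sub>\<infinity>j\<in>?D. 1 * pmf ?p j) + ennreal (\<Sum>\<^sub>\<infinity>j\<in>?C. u j ?\<nu> * pmf ?p j)"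
    by (subst (1 2) nn_integral_pmf_eq_infsum) (use u' in auto)
  also have "\<dots> = ennreal (?c * (\<Sum>\<^sub>\<infinity>j\<in>?D. pmf ?p j) + (\<Sum>\<^sub>\<infinity>j\<in>?C. u j ?\<nu> * pmf ?p j))"
    using u' by (subst ennreal_mult[symmetric], simp, simp add: infsum_nonneg, subst ennreal_plus[symmetric])
      (auto intro!: infsum_nonneg)
  also have "?c = indicator {\<mu> k..} (reward G n k i a)"
    by (simp add: next_goals_def indicator_def)
  finally show ?thesis by (simp add: T_action_def)
qed

lemma T_mixed_eq_nn_integral:
  fixes G :: "('s, 'k::finite, 'a) game"
  assumes gm: "game_model G" and i: "i \<in> states G n" and \<phi>: "\<And>l. set_pmf (\<phi> l) \<subseteq> acts G n l i"
    and u: "u \<in> goal_functions G (Suc n) k"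
  shows "ennreal (T_mixed G n k \<phi> u i \<mu>) =
    (\<integral>\<^sup>+a. \<integral>\<^sup>+j. ennreal (with_boundary G k u j (next_goals G n i \<mu> a)) \<partial>transition G n i a
       \<partial>Pi_pmf UNIV undefined \<phi>)"
proof -
  let ?q = "Pi_pmf UNIV undefined \<phi>" and ?A = "joint_acts G n i"
  note fin = finite_joint_acts[OF gm i]
  have supp: "set_pmf ?q \<subseteq> ?A"
    using \<phi> by (auto simp: joint_acts_def set_Pi_pmf PiE_dflt_def subset_iff)
  have "(\<integral>\<^sup>+a. \<integral>\<^sup>+j. ennreal (with_boundary G k u j (next_goals G n i \<mu> a)) \<partial>transition G n i a \<partial>?q) =
      (\<integral>\<^sup>+a. ennreal (T_action G n k a u i \<mu>) \<partial>?q)"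
    using supp by (intro nn_integral_cong_AE)
      (auto simp: AE_measure_pmf_iff T_action_eq_nn_integral[OF gm i _ u])
  also have "\<dots> = (\<Sum>a\<in>?A. ennreal (T_action G n k a u i \<mu>) * ennreal (pmf ?q a))"
    by (rule nn_integral_measure_pmf_support) (use fin supp in auto)
  also have "\<dots> = ennreal (\<Sum>a\<in>?A. T_action G n k a u i \<mu> * pmf ?q a)"
    using T_action_nonneg[OF u] by (subst sum_ennreal[symmetric]) (auto simp: ennreal_mult)
  also have "(\<Sum>a\<in>?A. T_action G n k a u i \<mu> * pmf ?q a) = T_mixed G n k \<phi> u i \<mu>"
    by (simp add: T_mixed_def pmf_Pi)
  finally show ?thesis by simp
qed

section \<open>The stopped value process\<close>

text \<open>
  The value of a history is read off at its first visit to the target, and at its last state if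
  there was none. Reading it off a list of completed stages makes its evolution stop by itself:
  appending a stage does not change a first visit that has already occurred.
\<close>

definition stopped_value ::
    "('s, 'k, 'a) game \<Rightarrow> 'k \<Rightarrow> (nat \<Rightarrow> 's \<Rightarrow> 'k goals \<Rightarrow> real) \<Rightarrow> ('s, 'k, 'a) history \<Rightarrow> real" where
  "stopped_value G k u h =
     (case List.find (\<lambda>s. fst s \<in> target G) (fst h) of
        Some s \<Rightarrow> of_bool (fst (snd s) k \<le> 0)
      | None \<Rightarrow> with_boundary G k (u (length (fst h))) (cur_state h) (cur_goals h))"

definition stopped :: "('s, 'k, 'a) game \<Rightarrow> ('s, 'k, 'a) history \<Rightarrow> bool" where
  "stopped G h \<longleftrightarrow> cur_state h \<in> target G \<or> (\<exists>s\<in>set (fst h). fst s \<in> target G)"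

lemma find_append: "List.find P (xs @ ys) = (case List.find P xs of None \<Rightarrow> List.find P ys | Some x \<Rightarrow> Some x)"
  by (induction xs) auto

lemma stopped_value_next_stopped:
  assumes "stopped G h"
  shows "stopped_value G k u (next_history G n h a j) = stopped_value G k u h"
proof (cases "List.find (\<lambda>s. fst s \<in> target G) (fst h)")
  case None
  then have "cur_state h \<in> target G"
    using assms unfolding find_None_iff stopped_def by blast
  with None show ?thesis
    by (simp add: stopped_value_def next_history_def find_append with_boundary_def)
qed (simp add: stopped_value_def next_history_def find_append)

lemma stopped_value_not_stopped:
  assumes "\<not> stopped G h" "length (fst h) = n"
  shows "stopped_value G k u h = u n (cur_state h) (cur_goals h)"
    and "stopped_value G k u (next_history G n h a j) =
      with_boundary G k (u (Suc n)) j (next_goals G n (cur_state h) (cur_goals h) a)"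
proof -
  have "List.find (\<lambda>s. fst s \<in> target G) (fst h) = None"
    using assms(1) by (auto simp: find_None_iff stopped_def)
  with assms show "stopped_value G k u h = u n (cur_state h) (cur_goals h)"
    "stopped_value G k u (next_history G n h a j) =
      with_boundary G k (u (Suc n)) j (next_goals G n (cur_state h) (cur_goals h) a)"
    by (auto simp: stopped_value_def next_history_def find_append with_boundary_def stopped_def)
qed

text \<open>
  One step of the stopped process: a stopped value stays as it is, and otherwise the value one step
  later averages to \<open>T u\<^bsub>n+1\<^esub>\<close>.
\<close>

lemma nn_integral_stopped_value_next:
  assumes gm: "game_model G" and \<pi>: "\<pi> \<in> multipolicies G" and h: "h \<in> histories G n"
    and u: "u (Suc n) \<in> goal_functions G (Suc n) k"
  shows "(\<integral>\<^sup>+a. \<integral>\<^sup>+j. ennreal (stopped_value G k u (next_history G n h a j))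
            \<partial>transition G n (cur_state h) a \<partial>joint_action_pmf \<pi> n h) =
    (if stopped G h then ennreal (stopped_value G k u h)
     else ennreal (T_mixed G n k (\<lambda>l. \<pi> l n h) (u (Suc n)) (cur_state h) (cur_goals h)))"
proof (cases "stopped G h")
  case True
  then show ?thesis by (simp add: stopped_value_next_stopped)
next
  case False
  have "length (fst h) = n" "cur_state h \<in> states G n"
    using h by (cases h; simp add: histories_eq)+
  moreover have "set_pmf (\<pi> l n h) \<subseteq> acts G n l (cur_state h)" for l
    using \<pi> h by (auto simp: multipolicies_def policies_def)
  ultimately show ?thesis
    using False by (simp add: stopped_value_not_stopped T_mixed_eq_nn_integral[OF gm _ _ u] joint_action_pmf_def)
qed

definition expected_stopped_value ::
    "('s, 'k::finite, 'a) game \<Rightarrow> ('k \<Rightarrow> ('s, 'k, 'a) policy) \<Rightarrow> 'k \<Rightarrow> (nat \<Rightarrow> 's \<Rightarrow> 'k goals \<Rightarrow> real)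
       \<Rightarrow> ('s \<times> 'k goals) pmf \<Rightarrow> nat \<Rightarrow> ennreal" where
  "expected_stopped_value G \<pi> k u \<gamma> n = (\<integral>\<^sup>+h. ennreal (stopped_value G k u h) \<partial>history_pmf G \<gamma> \<pi> n)"

lemma expected_stopped_value_0:
  assumes "i \<notin> target G"
  shows "expected_stopped_value G \<pi> k u (return_pmf (i, \<mu>)) 0 = ennreal (u 0 i \<mu>)"
  using assms by (simp add: expected_stopped_value_def stopped_value_def with_boundary_def)

text \<open>
  In this form the expectations at two consecutive times differ only where the history has not
  stopped, by replacing \<open>u\<^sub>n\<close> with \<open>T u\<^bsub>n+1\<^esub>\<close>.
\<close>

lemma expected_stopped_value_step:
  assumes gm: "game_model G" and \<gamma>: "initial_distribution G \<gamma>" and \<pi>: "\<pi> \<in> multipolicies G"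
    and u: "u (Suc n) \<in> goal_functions G (Suc n) k"
  shows "expected_stopped_value G \<pi> k u \<gamma> n = (\<integral>\<^sup>+h.
      (if stopped G h then ennreal (stopped_value G k u h)
       else ennreal (u n (cur_state h) (cur_goals h))) \<partial>history_pmf G \<gamma> \<pi> n)" (is ?now)
    and "expected_stopped_value G \<pi> k u \<gamma> (Suc n) = (\<integral>\<^sup>+h.
      (if stopped G h then ennreal (stopped_value G k u h)
       else ennreal (T_mixed G n k (\<lambda>l. \<pi> l n h) (u (Suc n)) (cur_state h) (cur_goals h)))
      \<partial>history_pmf G \<gamma> \<pi> n)" (is ?after)
proof -
  have h: "h \<in> histories G n" "length (fst h) = n" if "h \<in> set_pmf (history_pmf G \<gamma> \<pi> n)" for h
  proof -
    show "h \<in> histories G n" using that set_history_pmf[OF gm \<gamma> \<pi>] by blast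
    then show "length (fst h) = n" by (cases h) (simp add: histories_eq)
  qed
  show ?now
    unfolding expected_stopped_value_def using h(2)
    by (intro nn_integral_cong_AE) (auto simp: AE_measure_pmf_iff stopped_value_not_stopped)
  show ?after
    unfolding expected_stopped_value_def using h(1)
    by (simp only: history_pmf.simps nn_integral_bind_pmf nn_integral_map_pmf)
       (intro nn_integral_cong_AE, simp add: AE_measure_pmf_iff nn_integral_stopped_value_next[where u = u, OF gm \<pi> _ u])
qed

lemma incseq_expected_stopped_value:
  assumes gm: "game_model G" and \<gamma>: "initial_distribution G \<gamma>" and \<pi>: "\<pi> \<in> multipolicies G"
    and u: "\<And>n. u n \<in> goal_functions G n k"
    and le: "\<And>n h. h \<in> histories G n \<Longrightarrow> cur_state h \<notin> target G \<Longrightarrow>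
      u n (cur_state h) (cur_goals h)
        \<le> T_mixed G n k (\<lambda>l. \<pi> l n h) (u (Suc n)) (cur_state h) (cur_goals h)"
  shows "incseq (expected_stopped_value G \<pi> k u \<gamma>)"
proof (rule incseq_SucI)
  show "expected_stopped_value G \<pi> k u \<gamma> n \<le> expected_stopped_value G \<pi> k u \<gamma> (Suc n)" for n
    unfolding expected_stopped_value_step(1)[where u = u and n = n, OF gm \<gamma> \<pi> u]
      expected_stopped_value_step(2)[where u = u and n = n, OF gm \<gamma> \<pi> u]
    using set_history_pmf[OF gm \<gamma> \<pi>, of n] le[of _ n]
    by (intro nn_integral_mono_AE) (auto simp: AE_measure_pmf_iff stopped_def intro!: ennreal_leI)
qed

lemma decseq_expected_stopped_value:
  assumes gm: "game_model G" and \<gamma>: "initial_distribution G \<gamma>" and \<pi>: "\<pi> \<in> multipolicies G"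
    and u: "\<And>n. u n \<in> goal_functions G n k"
    and ge: "\<And>n h. h \<in> histories G n \<Longrightarrow> cur_state h \<notin> target G \<Longrightarrow>
      u n (cur_state h) (cur_goals h)
        \<ge> T_mixed G n k (\<lambda>l. \<pi> l n h) (u (Suc n)) (cur_state h) (cur_goals h)"
  shows "decseq (expected_stopped_value G \<pi> k u \<gamma>)"
proof (rule decseq_SucI)
  show "expected_stopped_value G \<pi> k u \<gamma> (Suc n) \<le> expected_stopped_value G \<pi> k u \<gamma> n" for n
    unfolding expected_stopped_value_step(1)[where u = u and n = n, OF gm \<gamma> \<pi> u]
      expected_stopped_value_step(2)[where u = u and n = n, OF gm \<gamma> \<pi> u]
    using set_history_pmf[OF gm \<gamma> \<pi>, of n] ge[of _ n]
    by (intro nn_integral_mono_AE) (auto simp: AE_measure_pmf_iff stopped_def intro!: ennreal_leI)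
qed

section \<open>Convergence to the criterion\<close>

lemma passage_time_finite_iff:
  "passage_time G n \<omega> < \<infinity> \<longleftrightarrow> (\<exists>t\<ge>n. state_at \<omega> t \<in> target G)"
proof
  assume "passage_time G n \<omega> < \<infinity>"
  then obtain t where t: "passage_time G n \<omega> = enat t" by auto
  have "\<not> enat t < passage_time G n \<omega>" by (simp add: t)
  then show "\<exists>t\<ge>n. state_at \<omega> t \<in> target G"
    unfolding less_passage_time_iff by auto
next
  assume "\<exists>t\<ge>n. state_at \<omega> t \<in> target G"
  then obtain t where "n \<le> t" "state_at \<omega> t \<in> target G" by blast
  then have "\<not> enat t < passage_time G n \<omega>"
    unfolding less_passage_time_iff by auto
  then show "passage_time G n \<omega> < \<infinity>" by (cases "passage_time G n \<omega>") auto
qed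

lemma passage_reward_first_visit:
  assumes "state_at \<omega> t \<in> target G" "\<And>s. s < t \<Longrightarrow> state_at \<omega> s \<notin> target G"
  shows "passage_reward G 0 k \<omega> = ereal (of_rat (\<Sum>s<t. reward G s k (state_at \<omega> s) (acts_at \<omega> s)))"
proof -
  have *: "enat s < passage_time G 0 \<omega> \<longleftrightarrow> s < t" for s
    unfolding less_passage_time_iff using assms by (metis atLeastAtMost_iff le_less_trans not_less zero_le)
  have "passage_reward G 0 k \<omega> = (\<Sum>s<t. ereal (of_rat (reward G s k (state_at \<omega> s) (acts_at \<omega> s))))"
    unfolding passage_reward_def * by (subst suminf_finite[of "{..<t}"]) auto
  then show ?thesis by (simp add: of_rat_sum)
qed

lemma goals_at_eq_diff_sum:
  assumes "\<And>t. goals_at \<omega> (Suc t) = next_goals G t (state_at \<omega> t) (goals_at \<omega> t) (acts_at \<omega> t)"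
  shows "goals_at \<omega> n k = goals_at \<omega> 0 k - (\<Sum>t<n. reward G t k (state_at \<omega> t) (acts_at \<omega> t))"
  by (induction n) (simp_all add: assms next_goals_def)

text \<open>
  Along a trajectory that obeys the goal dynamics, the goal at time \<open>t\<close> is what is left of the
  initial goal after the rewards collected before \<open>t\<close>.
\<close>

lemma goal_met_iff_first_visit:
  assumes "state_at \<omega> t \<in> target G" "\<And>s. s < t \<Longrightarrow> state_at \<omega> s \<notin> target G"
    and "\<And>t. goals_at \<omega> (Suc t) = next_goals G t (state_at \<omega> t) (goals_at \<omega> t) (acts_at \<omega> t)"
  shows "ereal (of_rat (goals_at \<omega> 0 k)) \<le> passage_reward G 0 k \<omega> \<longleftrightarrow> goals_at \<omega> t k \<le> 0"
  by (simp add: passage_reward_first_visit[where \<omega> = \<omega> and t = t, OF assms(1,2)]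
      goals_at_eq_diff_sum[where \<omega> = \<omega> and n = t, OF assms(3)] of_rat_less_eq)

lemma stopped_value_history_at:
  assumes "state_at \<omega> t \<in> target G" "\<And>s. s < t \<Longrightarrow> state_at \<omega> s \<notin> target G" "t \<le> n"
  shows "stopped_value G k u (history_at \<omega> n) = of_bool (goals_at \<omega> t k \<le> 0)"
proof (cases "t = n")
  case True
  have "List.find (\<lambda>s. fst s \<in> target G) (map \<omega> [0..<n]) = None"
    using assms(2) True by (auto simp: find_None_iff)
  with True assms(1) show ?thesis
    by (simp add: stopped_value_def history_at_def with_boundary_def)
next
  case False
  have "List.find (\<lambda>s. fst s \<in> target G) (map \<omega> [0..<n]) = Some (\<omega> t)"
    using assms False unfolding find_Some_iff by (intro exI[of _ t]) auto
  then show ?thesis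
    by (simp add: stopped_value_def history_at_def)
qed

lemma stopped_value_le_1:
  assumes "h \<in> histories G n" "u n \<in> goal_functions G n k"
  shows "stopped_value G k u h \<le> 1"
  using assms
  by (cases h) (auto simp: stopped_value_def with_boundary_def goal_functions_def histories_eq split: option.split)

text \<open>
  The space of trajectories leaves the goals free; only almost surely do they follow the rewards.
\<close>

lemma AE_next_goals:
  assumes "game_model G" "initial_distribution G \<gamma>" "\<pi> \<in> multipolicies G"
  shows "AE \<omega> in law G \<gamma> \<pi>.
    \<forall>t. goals_at \<omega> (Suc t) = next_goals G t (state_at \<omega> t) (goals_at \<omega> t) (acts_at \<omega> t)"
  unfolding AE_all_countable
proof
  fix t
  define Q where "Q h = (case last (fst h) of (i, \<mu>, a) \<Rightarrow> cur_goals h = next_goals G t i \<mu> a)"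
    for h :: "('a, 'b, 'c) history"
  have "AE \<omega> in law G \<gamma> \<pi>. Q (history_at \<omega> (Suc t))"
    unfolding AE_history_at_iff[OF assms] by (auto simp: Q_def next_history_def)
  then show "AE \<omega> in law G \<gamma> \<pi>. goals_at \<omega> (Suc t) = next_goals G t (state_at \<omega> t) (goals_at \<omega> t) (acts_at \<omega> t)"
    by (simp add: Q_def history_at_def case_prod_beta')
qed

lemma AE_initial:
  assumes "game_model G" "i \<in> states G 0" "\<pi> \<in> multipolicies G"
  shows "AE \<omega> in law G (return_pmf (i, \<mu>)) \<pi>. state_at \<omega> 0 = i \<and> goals_at \<omega> 0 = \<mu>"
  using AE_history_at_iff[where Q = "\<lambda>h. snd h = (i, \<mu>)" and n = 0,
      OF assms(1) initial_distribution_return[OF assms(2), of \<mu>] assms(3)]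
  by (simp add: history_at_def)

lemma sets_goal_met:
  assumes "game_model G" "initial_distribution G \<gamma>" "\<pi> \<in> multipolicies G"
  shows "{\<omega> \<in> space (law G \<gamma> \<pi>). c \<le> passage_reward G n k \<omega>} \<in> sets (law G \<gamma> \<pi>)"
proof -
  have "{\<omega> \<in> space (PiM UNIV (stage_space G)). c \<le> passage_reward G n k \<omega>} \<in> sets (PiM UNIV (stage_space G))"
    by measurable
  then show ?thesis
    by (simp add: sets_law[OF assms] space_law[OF assms] space_PiM_stage_space)
qed

text \<open>
  From the first visit on, the stopped value is the indicator that the initial goal has been met.
  Stopped values lie between zero and one, so dominated convergence applies.
\<close>

lemma expected_stopped_value_tendsto:
  assumes gm: "game_model G" and i: "i \<in> states G 0" and \<pi>: "\<pi> \<in> multipolicies G"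
    and u: "\<And>n. u n \<in> goal_functions G n k"
    and finite: "AE \<omega> in law G (return_pmf (i, \<mu>)) \<pi>. passage_time G 0 \<omega> < \<infinity>"
  shows "expected_stopped_value G \<pi> k u (return_pmf (i, \<mu>)) \<longlonglongrightarrow> ennreal (F0 G \<pi> k i \<mu>)"
proof -
  let ?\<gamma> = "return_pmf (i, \<mu>)"
  let ?P = "law G ?\<gamma> \<pi>"
  let ?S = "{\<omega> \<in> space ?P. ereal (of_rat (\<mu> k)) \<le> passage_reward G 0 k \<omega>}"
  have \<gamma>: "initial_distribution G ?\<gamma>" by (rule initial_distribution_return[OF i])
  interpret P: prob_space ?P by (rule prob_space_law[OF gm \<gamma> \<pi>])
  have S: "?S \<in> sets ?P" by (rule sets_goal_met[OF gm \<gamma> \<pi>])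
  have "(\<lambda>n. \<integral>\<^sup>+\<omega>. ennreal (stopped_value G k u (history_at \<omega> n)) \<partial>?P) \<longlonglongrightarrow> (\<integral>\<^sup>+\<omega>. indicator ?S \<omega> \<partial>?P)"
  proof (rule nn_integral_dominated_convergence[where w = "\<lambda>_. 1"])
    show "(\<lambda>\<omega>. ennreal (stopped_value G k u (history_at \<omega> n))) \<in> borel_measurable ?P" for n
      by (rule measurable_compose[OF measurable_history_at[OF gm \<gamma> \<pi>]]) simp
    show "AE \<omega> in ?P. ennreal (stopped_value G k u (history_at \<omega> n)) \<le> 1" for n
    proof (rule AE_I2)
      fix \<omega> assume "\<omega> \<in> space ?P"
      then have "history_at \<omega> n \<in> histories G n"
        by (simp add: space_law[OF gm \<gamma> \<pi>] history_at_histories)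
      then show "ennreal (stopped_value G k u (history_at \<omega> n)) \<le> 1"
        using stopped_value_le_1[where u = u, OF _ u] by simp
    qed
    show "AE \<omega> in ?P. (\<lambda>n. ennreal (stopped_value G k u (history_at \<omega> n))) \<longlonglongrightarrow> indicator ?S \<omega>"
      using finite AE_next_goals[OF gm \<gamma> \<pi>] AE_initial[OF gm i \<pi>, of \<mu>] AE_space
    proof eventually_elim
      case (elim \<omega>)
      define t where "t = (LEAST t. state_at \<omega> t \<in> target G)"
      have "\<exists>t. state_at \<omega> t \<in> target G"
        using elim(1) unfolding passage_time_finite_iff by blast
      then have t: "state_at \<omega> t \<in> target G" "\<And>s. s < t \<Longrightarrow> state_at \<omega> s \<notin> target G"
        unfolding t_def by (auto intro: LeastI_ex dest: not_less_Least)
      have "indicator ?S \<omega> = ennreal (of_bool (goals_at \<omega> t k \<le> 0))"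
        using goal_met_iff_first_visit[where \<omega> = \<omega> and t = t and k = k, OF t] elim by (auto simp: indicator_def)
      moreover have "stopped_value G k u (history_at \<omega> n) = of_bool (goals_at \<omega> t k \<le> 0)" if "t \<le> n" for n
        using t that by (rule stopped_value_history_at)
      ultimately show ?case
        by (intro tendsto_eventually) (auto simp: eventually_sequentially intro!: exI[of _ t])
    qed
  qed (use S in \<open>simp_all add: P.emeasure_space_1\<close>)
  also have "(\<lambda>n. \<integral>\<^sup>+\<omega>. ennreal (stopped_value G k u (history_at \<omega> n)) \<partial>?P) = expected_stopped_value G \<pi> k u ?\<gamma>"
    unfolding expected_stopped_value_def
    by (rule ext, rule nn_integral_history_at[OF gm \<gamma> \<pi>])
  also have "(\<integral>\<^sup>+\<omega>. indicator ?S \<omega> \<partial>?P) = ennreal (F0 G \<pi> k i \<mu>)"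
    using S by (simp add: F0_def P.emeasure_eq_measure)
  finally show ?thesis .
qed

text \<open>
  Stated for one initial state and its almost sure passage, rather than under Assumption A, so that
  it also applies to the shifted games, some of whose states need not reach the target.
\<close>

lemma comparison_le:
  assumes gm: "game_model G" and i: "i \<in> states G 0" "i \<notin> target G" and \<pi>: "\<pi> \<in> multipolicies G"
    and u: "\<And>n. u n \<in> goal_functions G n k"
    and finite: "AE \<omega> in law G (return_pmf (i, \<mu>)) \<pi>. passage_time G 0 \<omega> < \<infinity>"
    and le: "\<And>n h. h \<in> histories G n \<Longrightarrow> cur_state h \<notin> target G \<Longrightarrow>
      u n (cur_state h) (cur_goals h)
        \<le> T_mixed G n k (\<lambda>l. \<pi> l n h) (u (Suc n)) (cur_state h) (cur_goals h)"
  shows "u 0 i \<mu> \<le> F0 G \<pi> k i \<mu>"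
proof -
  note \<gamma> = initial_distribution_return[OF i(1)]
  have "ennreal (u 0 i \<mu>) \<le> ennreal (F0 G \<pi> k i \<mu>)"
    unfolding expected_stopped_value_0[OF i(2), of \<pi> k u \<mu>, symmetric]
    by (intro incseq_le expected_stopped_value_tendsto incseq_expected_stopped_value
        gm \<gamma> \<pi> u le i finite) 
  then show ?thesis by (simp add: F0_def)
qed

lemma comparison_ge:
  assumes gm: "game_model G" and i: "i \<in> states G 0" "i \<notin> target G" and \<pi>: "\<pi> \<in> multipolicies G"
    and u: "\<And>n. u n \<in> goal_functions G n k"
    and finite: "AE \<omega> in law G (return_pmf (i, \<mu>)) \<pi>. passage_time G 0 \<omega> < \<infinity>"
    and ge: "\<And>n h. h \<in> histories G n \<Longrightarrow> cur_state h \<notin> target G \<Longrightarrow>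
      u n (cur_state h) (cur_goals h)
        \<ge> T_mixed G n k (\<lambda>l. \<pi> l n h) (u (Suc n)) (cur_state h) (cur_goals h)"
  shows "u 0 i \<mu> \<ge> F0 G \<pi> k i \<mu>"
proof -
  note \<gamma> = initial_distribution_return[OF i(1)]
  have "ennreal (F0 G \<pi> k i \<mu>) \<le> ennreal (u 0 i \<mu>)"
    unfolding expected_stopped_value_0[OF i(2), of \<pi> k u \<mu>, symmetric]
    by (intro decseq_ge expected_stopped_value_tendsto decseq_expected_stopped_value
        gm \<gamma> \<pi> u ge i finite)
  moreover have "0 \<le> u 0 i \<mu>"
    using u[of 0] i by (simp add: goal_functions_def)
  ultimately show ?thesis by simp
qed

section \<open>Almost sure passage from attainable states\<close>

lemma sets_passage_time_finite:
  "{\<omega> \<in> PiE UNIV (stages G). passage_time G n \<omega> < \<infinity>} \<in> sets (PiM UNIV (stage_space G))"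
proof -
  have [measurable]: "Measurable.pred (PiM UNIV (stage_space G)) (\<lambda>\<omega>. state_at \<omega> t \<in> target G)" for t
    by (rule measurable_compose[OF measurable_component_singleton[of t]]) (auto simp: stage_space_def)
  have "{\<omega> \<in> space (PiM UNIV (stage_space G)). \<exists>t\<ge>n. state_at \<omega> t \<in> target G} \<in> sets (PiM UNIV (stage_space G))"
    by measurable
  then show ?thesis unfolding passage_time_finite_iff space_PiM_stage_space .
qed

lemma assumption_A_AE:
  assumes gm: "game_model G" and A: "assumption_A G" and \<gamma>: "initial_distribution G \<gamma>"
    and \<pi>: "\<pi> \<in> multipolicies G" and h: "h \<in> histories G n" "cur_state h \<notin> target G"
  shows "AE \<omega> in law G \<gamma> \<pi>. history_at \<omega> n = h \<longrightarrow> passage_time G n \<omega> < \<infinity>"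
proof -
  let ?P = "law G \<gamma> \<pi>"
  let ?H = "{\<omega> \<in> space ?P. history_at \<omega> n = h}" and ?E = "{\<omega> \<in> space ?P. passage_time G n \<omega> < \<infinity>}"
  interpret P: prob_space ?P by (rule prob_space_law[OF gm \<gamma> \<pi>])
  have E: "?E \<in> sets ?P"
    using sets_passage_time_finite[of G n] by (simp add: sets_law[OF gm \<gamma> \<pi>] space_law[OF gm \<gamma> \<pi>])
  have "(\<lambda>\<omega>. history_at \<omega> n) -` {h} \<inter> space ?P \<in> sets ?P"
    by (rule measurable_sets[OF measurable_history_at[OF gm \<gamma> \<pi>]]) simp
  also have "(\<lambda>\<omega>. history_at \<omega> n) -` {h} \<inter> space ?P = ?H" by auto
  finally have H: "?H \<in> sets ?P" .
  have "P.prob (?H - ?E) = 0"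
  proof (cases "P.prob ?H = 0")
    case True
    then show ?thesis
      using P.finite_measure_mono[of "?H - ?E" ?H] H by (simp add: measure_le_0_iff)
  next
    case False
    then have "0 < P.prob ?H" by (simp add: zero_less_measure_iff)
    from A[unfolded assumption_A_def, rule_format, OF \<gamma> \<pi> h this]
    have "P.prob {\<omega> \<in> space ?P. passage_time G n \<omega> < \<infinity> \<and> history_at \<omega> n = h} = P.prob ?H"
      unfolding cond_prob_def using False by simp
    also have "{\<omega> \<in> space ?P. passage_time G n \<omega> < \<infinity> \<and> history_at \<omega> n = h} = ?H \<inter> ?E" by auto
    finally show ?thesis
      using P.finite_measure_Diff'[OF H E] by simp
  qed
  then have "?H - ?E \<in> null_sets ?P"
    using H E by (auto simp: null_sets_def P.emeasure_eq_measure)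
  then show ?thesis
    by (rule AE_I') auto
qed

lemma AE_passage_time_0:
  assumes gm: "game_model G" and A: "assumption_A G" and \<pi>: "\<pi> \<in> multipolicies G"
    and i: "i \<in> states G 0" "i \<notin> target G"
  shows "AE \<omega> in law G (return_pmf (i, \<mu>)) \<pi>. passage_time G 0 \<omega> < \<infinity>"
proof -
  have "AE \<omega> in law G (return_pmf (i, \<mu>)) \<pi>. history_at \<omega> 0 = ([], i, \<mu>) \<longrightarrow> passage_time G 0 \<omega> < \<infinity>"
    using i by (intro assumption_A_AE[OF gm A initial_distribution_return \<pi>]) auto
  with AE_initial[OF gm i(1) \<pi>, of \<mu>] show ?thesis
    by eventually_elim (simp add: history_at_def)
qed

lemma attainable_states:
  assumes "game_model G" "attainable G n i" shows "i \<in> states G n"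
  using assms(2)
proof induction
  case (step n i a j)
  then have "j \<in> set_pmf (transition G n i a)" by (simp add: set_pmf_iff)
  with step assms(1) show ?case by (auto simp: game_model_def subset_iff)
qed

text \<open>
  An attainable state can be reached with any prescribed goals, since the initial goals are free.
  The actions that lead there are played before time \<open>n\<close>, so the multipolicy can agree with \<open>\<phi>\<close>
  from time \<open>n\<close> on, which is all that the process shifted to \<open>n\<close> depends on.
\<close>

lemma attainable_reached:
  assumes gm: "game_model G" and "attainable G n i" and \<phi>: "\<phi> \<in> markov_multipolicies G"
  shows "\<exists>\<gamma> \<phi>'. initial_distribution G \<gamma> \<and> \<phi>' \<in> markov_multipolicies G \<and>
    (\<forall>l t. n \<le> t \<longrightarrow> \<phi>' l t = \<phi> l t) \<and>
    (\<exists>hs. (hs, i, \<mu>) \<in> set_pmf (history_pmf G \<gamma> (of_markov \<phi>') n))"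
  using assms(2)
proof (induction arbitrary: \<mu>)
  case (start i)
  then show ?case
    using \<phi> by (intro exI[of _ "return_pmf (i, \<mu>)"] exI[of _ \<phi>]) (simp add: initial_distribution_return)
next
  case (step n i a j)
  \<comment> \<open>The goals at time \<open>n\<close> that become \<open>\<mu>\<close> when the reward for \<open>a\<close> is subtracted.\<close>
  let ?\<nu> = "\<lambda>k. \<mu> k + reward G n k i a"
  from step.IH[of ?\<nu>] obtain \<gamma> \<phi>' hs where IH: "initial_distribution G \<gamma>" "\<phi>' \<in> markov_multipolicies G"
    "\<And>l t. n \<le> t \<Longrightarrow> \<phi>' l t = \<phi> l t" "(hs, i, ?\<nu>) \<in> set_pmf (history_pmf G \<gamma> (of_markov \<phi>') n)"
    by blast
  \<comment> \<open>In state \<open>i\<close> at time \<open>n\<close> play \<open>a\<close> for certain. The history up to time \<open>n\<close> has the same law as before.\<close>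
  define \<phi>'' where "\<phi>'' l t i' \<mu>' = (if t = n \<and> i' = i then return_pmf (a l) else \<phi>' l t i' \<mu>')" for l t i' \<mu>'
  have mm: "\<phi>'' \<in> markov_multipolicies G"
    using IH(2) step.hyps(2)
    by (auto simp: \<phi>''_def markov_multipolicies_def markov_policies_def joint_acts_def)
  have later: "\<phi>'' l t = \<phi> l t" if "Suc n \<le> t" for l t
    using IH(3)[of t l] that by (auto simp: \<phi>''_def fun_eq_iff)
  have "history_pmf G \<gamma> (of_markov \<phi>'') n = history_pmf G \<gamma> (of_markov \<phi>') n"
    by (rule history_pmf_cong) (simp add: of_markov_def \<phi>''_def)
  then have "(hs, i, ?\<nu>) \<in> set_pmf (history_pmf G \<gamma> (of_markov \<phi>'') n)"
    using IH(4) by simp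
  moreover have "a \<in> set_pmf (joint_action_pmf (of_markov \<phi>'') n (hs, i, ?\<nu>))"
    by (simp add: joint_action_pmf_def of_markov_def \<phi>''_def set_Pi_pmf PiE_dflt_def)
  moreover have "j \<in> set_pmf (transition G n i a)"
    using step.hyps(3) by (simp add: set_pmf_iff)
  moreover have "next_history G n (hs, i, ?\<nu>) a j = (hs @ [(i, ?\<nu>, a)], j, \<mu>)"
    by (simp add: next_history_def next_goals_def)
  ultimately have "(hs @ [(i, ?\<nu>, a)], j, \<mu>) \<in> set_pmf (history_pmf G \<gamma> (of_markov \<phi>'') (Suc n))"
    unfolding history_pmf.simps set_bind_pmf set_map_pmf
    by (intro UN_I[of "(hs, i, ?\<nu>)"] UN_I[of a] image_eqI[of _ _ j]) simp_all
  with IH(1) mm later show ?case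
    by (intro exI[of _ \<gamma>] exI[of _ \<phi>''] exI[of _ "hs @ [(i, ?\<nu>, a)]"] conjI allI impI)
qed

text \<open>
  Let the original process follow a multipolicy that reaches \<open>(i, \<mu>)\<close> at time \<open>n\<close> with positive
  probability and agrees with \<open>\<phi>\<close> afterwards. Almost all of its trajectories through \<open>(i, \<mu>)\<close> at
  time \<open>n\<close> reach the target later, and given such a passage the Markov property makes the future
  a copy of the shifted process.
\<close>

lemma AE_passage_time_shift:
  fixes G :: "('s, 'k::finite, 'a) game"
  assumes gm: "game_model G" and A: "assumption_A G" and \<phi>: "\<phi> \<in> markov_multipolicies G"
    and i: "attainable G n i" "i \<notin> target G"
  shows "AE \<omega> in law (shift_game n G) (return_pmf (i, \<mu>)) (of_markov (\<lambda>l t. \<phi> l (n + t))).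
    passage_time (shift_game n G) 0 \<omega> < \<infinity>"
proof -
  obtain \<gamma> \<phi>' hs where \<gamma>: "initial_distribution G \<gamma>" and \<phi>': "\<phi>' \<in> markov_multipolicies G"
    and later: "\<And>l t. n \<le> t \<Longrightarrow> \<phi>' l t = \<phi> l t"
    and reached: "(hs, i, \<mu>) \<in> set_pmf (history_pmf G \<gamma> (of_markov \<phi>') n)"
    using attainable_reached[OF gm i(1) \<phi>, of \<mu>] by (elim exE conjE) (rule that; simp)
  let ?G = "shift_game n G" and ?P = "law G \<gamma> (of_markov \<phi>')"
  let ?P' = "law ?G (return_pmf (i, \<mu>)) (of_markov (\<lambda>l t. \<phi> l (n + t)))"
  let ?B = "{\<omega> \<in> PiE UNIV (stages G). state_at \<omega> n = i \<and> goals_at \<omega> n = \<mu>}"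
  let ?S = "{\<omega> \<in> PiE UNIV (stages ?G). passage_time ?G 0 \<omega> < \<infinity>}"
  note \<pi> = of_markov_multipolicies[OF \<phi>']
  note i' = attainable_states[OF gm i(1)]
  note shifted = game_model_shift[OF gm] initial_distribution_return[of i ?G \<mu>]
    of_markov_multipolicies[OF markov_multipolicies_shift[OF \<phi>]]
  interpret P: prob_space ?P by (rule prob_space_law[OF gm \<gamma> \<pi>])
  interpret P': prob_space ?P' using i' by (intro prob_space_law shifted) simp
  note space_P = space_law[OF gm \<gamma> \<pi>]
  have "(\<lambda>l t. \<phi>' l (n + t)) = (\<lambda>l t. \<phi> l (n + t))" by (simp add: later)
  note markov = markov_property[OF gm \<gamma> \<phi>' i' sets_passage_time_finite[of ?G 0], of \<mu>, unfolded this]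
  have "AE \<omega> in ?P. \<forall>h\<in>histories G n. cur_state h = i \<longrightarrow> history_at \<omega> n = h \<longrightarrow> passage_time G n \<omega> < \<infinity>"
    unfolding AE_ball_countable[OF countable_histories[OF gm]]
  proof
    fix h assume "h \<in> histories G n"
    then show "AE \<omega> in ?P. cur_state h = i \<longrightarrow> history_at \<omega> n = h \<longrightarrow> passage_time G n \<omega> < \<infinity>"
      using assumption_A_AE[OF gm A \<gamma> \<pi>] i(2) by (cases "cur_state h = i") auto
  qed
  then have "AE \<omega> in ?P. \<omega> \<in> {\<omega> \<in> ?B. (\<lambda>t. \<omega> (n + t)) \<in> ?S} \<longleftrightarrow> \<omega> \<in> ?B"
    using AE_space
  proof eventually_elim
    case (elim \<omega>)
    have "passage_time ?G 0 (\<lambda>t. \<omega> (n + t)) < \<infinity>" if \<omega>: "\<omega> \<in> ?B"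
    proof -
      have "history_at \<omega> n \<in> histories G n" "cur_state (history_at \<omega> n) = i"
        using \<omega> by (simp_all add: history_at_histories) (simp add: history_at_def)
      then have "passage_time G n \<omega> < \<infinity>" using elim(1) by blast
      then obtain t where "n \<le> t" "state_at \<omega> t \<in> target G"
        unfolding passage_time_finite_iff by blast
      then show ?thesis
        unfolding passage_time_finite_iff by (intro exI[of _ "t - n"]) simp
    qed
    moreover have "(\<lambda>t. \<omega> (n + t)) \<in> PiE UNIV (stages ?G)" if "\<omega> \<in> ?B"
      using that by (auto simp: PiE_iff stages_shift)
    ultimately have "(\<lambda>t. \<omega> (n + t)) \<in> ?S" if "\<omega> \<in> ?B" using that by blast
    then show ?case unfolding mem_Collect_eq by blast
  qed
  then have "emeasure ?P {\<omega> \<in> ?B. (\<lambda>t. \<omega> (n + t)) \<in> ?S} = emeasure ?P ?B"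
    by (rule emeasure_eq_AE) (rule markov(2,3))+
  then have "emeasure ?P ?B * emeasure ?P' ?S = emeasure ?P ?B"
    unfolding markov(1) .
  from arg_cong[OF this, of enn2real] have eq: "P.prob ?B * P'.prob ?S = P.prob ?B"
    by (simp only: measure_def enn2real_mult)
  have "P.prob ?B \<noteq> 0"
  proof
    assume "P.prob ?B = 0"
    then have "AE \<omega> in ?P. \<omega> \<notin> ?B"
      using markov(2) by (intro AE_not_in) (auto simp: null_sets_def P.emeasure_eq_measure)
    then have "AE \<omega> in ?P. snd (history_at \<omega> n) \<noteq> (i, \<mu>)"
      using AE_space by eventually_elim (auto simp: history_at_def space_P)
    then have "\<forall>h\<in>set_pmf (history_pmf G \<gamma> (of_markov \<phi>') n). snd h \<noteq> (i, \<mu>)"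
      unfolding AE_history_at_iff[where Q = "\<lambda>h. snd h \<noteq> (i, \<mu>)" and n = n, OF gm \<gamma> \<pi>] .
    from bspec[OF this reached] show False by simp
  qed
  with eq have "P'.prob ?S = 1" by simp
  from P'.AE_prob_1[OF this] show ?thesis
    by eventually_elim simp
qed

section \<open>The equation of the criteria under a Markov multipolicy\<close>

lemma passage_reward_nonneg:
  assumes gm: "game_model G" and \<omega>: "\<omega> \<in> PiE UNIV (stages G)"
  shows "0 \<le> reward G t k (state_at \<omega> t) (acts_at \<omega> t)" and "0 \<le> passage_reward G n k \<omega>"
proof -
  have *: "0 \<le> reward G t k (state_at \<omega> t) (acts_at \<omega> t)" for t
  proof -
    have "\<omega> t \<in> stages G t" using \<omega> by (auto simp: PiE_iff)
    with gm show ?thesis by (auto simp: stages_def game_model_def)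
  qed
  then show "0 \<le> reward G t k (state_at \<omega> t) (acts_at \<omega> t)" .
  show "0 \<le> passage_reward G n k \<omega>"
    unfolding passage_reward_def using * by (intro suminf_0_le) simp
qed

text \<open>
  Total rewards may be infinite when the target is never reached, so the first term is split off
  in the partial sums and the limit taken afterwards.
\<close>

lemma passage_reward_split_first:
  assumes gm: "game_model G" and \<omega>: "\<omega> \<in> PiE UNIV (stages G)" and "state_at \<omega> 0 \<notin> target G"
  shows "passage_reward G 0 k \<omega> =
    ereal (of_rat (reward G 0 k (state_at \<omega> 0) (acts_at \<omega> 0))) + passage_reward G (Suc 0) k \<omega>"
proof -
  let ?r = "\<lambda>t. ereal (of_rat (reward G t k (state_at \<omega> t) (acts_at \<omega> t)))"
  let ?f = "\<lambda>n t. if n \<le> t \<and> enat t < passage_time G n \<omega> then ?r t else 0"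
  have lim: "(\<lambda>m. \<Sum>t<Suc m. ?f n t) \<longlonglongrightarrow> passage_reward G n k \<omega>" for n
    unfolding passage_reward_def using passage_reward_nonneg(1)[OF gm \<omega>]
    by (intro LIMSEQ_Suc summable_LIMSEQ summable_ereal_pos) simp
  have "?f 0 (Suc t) = ?f (Suc 0) (Suc t)" for t
  proof -
    have "(\<forall>s\<in>{0..Suc t}. state_at \<omega> s \<notin> target G) \<longleftrightarrow> (\<forall>s\<in>{Suc 0..Suc t}. state_at \<omega> s \<notin> target G)"
      using assms(3) by (metis One_nat_def Suc_le_eq atLeastAtMost_iff gr0I zero_le)
    then show ?thesis unfolding less_passage_time_iff by simp
  qed
  moreover have "?f 0 0 = ?r 0"
    unfolding less_passage_time_iff using assms(3) by simp
  ultimately have "(\<Sum>t<Suc m. ?f 0 t) = (\<Sum>t<Suc m. ?f (Suc 0) t) + ?r 0" for m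
    unfolding sum.lessThan_Suc_shift by (simp add: add.commute)
  then have "(\<lambda>m. \<Sum>t<Suc m. ?f 0 t) \<longlonglongrightarrow> passage_reward G (Suc 0) k \<omega> + ?r 0"
    using passage_reward_nonneg(2)[OF gm \<omega>, of "Suc 0" k]
    by (simp only:) (intro tendsto_cadd_ereal lim; auto)
  from LIMSEQ_unique[OF lim this] show ?thesis by (simp add: add.commute)
qed

lemma F0_target:
  assumes gm: "game_model G" and i: "i \<in> target G" and \<pi>: "\<pi> \<in> multipolicies G"
  shows "F0 G \<pi> k i \<mu> = of_bool (\<mu> k \<le> 0)"
proof -
  let ?P = "law G (return_pmf (i, \<mu>)) \<pi>"
  have i0: "i \<in> states G 0" using gm i by (auto simp: game_model_def)
  note \<gamma> = initial_distribution_return[OF i0, of \<mu>]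
  interpret P: prob_space ?P by (rule prob_space_law[OF gm \<gamma> \<pi>])
  have "AE \<omega> in ?P. ereal (of_rat (\<mu> k)) \<le> passage_reward G 0 k \<omega> \<longleftrightarrow> \<mu> k \<le> 0"
    using AE_initial[OF gm i0 \<pi>, of \<mu>]
  proof eventually_elim
    case (elim \<omega>)
    then have "passage_reward G 0 k \<omega> = 0"
      using passage_reward_first_visit[of \<omega> 0 G k] i by (simp add: zero_ereal_def)
    then show ?case by simp
  qed
  then have "AE \<omega> in ?P. \<omega> \<in> {\<omega> \<in> space ?P. ereal (of_rat (\<mu> k)) \<le> passage_reward G 0 k \<omega>} \<longleftrightarrow>
      \<omega> \<in> {\<omega> \<in> space ?P. \<mu> k \<le> 0}"
    using AE_space by eventually_elim simp
  moreover have "{\<omega> \<in> space ?P. \<mu> k \<le> 0} \<in> sets ?P" by simp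
  ultimately have "F0 G \<pi> k i \<mu> = P.prob {\<omega> \<in> space ?P. \<mu> k \<le> 0}"
    unfolding F0_def by (intro measure_eq_AE sets_goal_met[OF gm \<gamma> \<pi>])
  then show ?thesis by (simp add: P.prob_space)
qed

lemma F0_bounds:
  assumes gm: "game_model G" and i: "i \<in> states G 0" and \<pi>: "\<pi> \<in> multipolicies G"
  shows "F0 G \<pi> k i \<mu> \<in> {0..1}" and "\<mu> k < 0 \<Longrightarrow> F0 G \<pi> k i \<mu> = 1"
proof -
  let ?P = "law G (return_pmf (i, \<mu>)) \<pi>"
  note \<gamma> = initial_distribution_return[OF i, of \<mu>]
  interpret P: prob_space ?P by (rule prob_space_law[OF gm \<gamma> \<pi>])
  show "F0 G \<pi> k i \<mu> \<in> {0..1}" by (simp add: F0_def)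
  assume "\<mu> k < 0"
  have "ereal (of_rat (\<mu> k)) \<le> passage_reward G 0 k \<omega>" if "\<omega> \<in> space ?P" for \<omega>
  proof -
    have "ereal (of_rat (\<mu> k)) \<le> 0" using \<open>\<mu> k < 0\<close> by simp
    also have "0 \<le> passage_reward G 0 k \<omega>"
      using that by (intro passage_reward_nonneg(2)[OF gm]) (simp add: space_law[OF gm \<gamma> \<pi>])
    finally show ?thesis .
  qed
  then have "{\<omega> \<in> space ?P. ereal (of_rat (\<mu> k)) \<le> passage_reward G 0 k \<omega>} = space ?P" by auto
  then show "F0 G \<pi> k i \<mu> = 1" by (simp add: F0_def P.prob_space)
qed

text \<open>
  A process started in the target collects nothing. So \<open>F\<close> itself has the boundary values of \<open>with_boundary\<close>.
\<close>

lemma F_target: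
  assumes "game_model G" "i \<in> target G" "\<phi> \<in> markov_multipolicies G"
  shows "F G \<phi> n k i \<mu> = of_bool (\<mu> k \<le> 0)"
  unfolding F_def using assms
  by (intro F0_target game_model_shift of_markov_multipolicies markov_multipolicies_shift) simp_all

lemma F_goal_functions:
  assumes "game_model G" "\<phi> \<in> markov_multipolicies G"
  shows "F G \<phi> n k \<in> goal_functions G n k"
  unfolding F_def goal_functions_def
  using F0_bounds[OF game_model_shift[OF assms(1)] _ of_markov_multipolicies[OF markov_multipolicies_shift[OF assms(2)]]]
  by auto

text \<open>
  After the first step the goal has been reduced by exactly the reward of that step, so the event
  that the initial goal is met is the event that the goal at time 1 is met from time 1 on. The
  Markov property at time 1, summed over the countably many states and goals, gives the claim.
\<close>

lemma F0_first_step: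
  assumes gm: "game_model G" and i: "i \<in> states G 0" "i \<notin> target G" and \<phi>: "\<phi> \<in> markov_multipolicies G"
  shows "ennreal (F0 G (of_markov \<phi>) k i \<mu>) =
    (\<integral>\<^sup>+h. ennreal (F G \<phi> (Suc 0) k (cur_state h) (cur_goals h))
       \<partial>history_pmf G (return_pmf (i, \<mu>)) (of_markov \<phi>) (Suc 0))"
proof -
  let ?\<gamma> = "return_pmf (i, \<mu>)" and ?\<pi> = "of_markov \<phi>" and ?G = "shift_game (Suc 0) G"
  let ?P = "law G ?\<gamma> ?\<pi>" and ?H = "history_pmf G ?\<gamma> ?\<pi> (Suc 0)" and ?C = "states G (Suc 0) \<times> (UNIV :: 'b goals set)"
  note \<gamma> = initial_distribution_return[OF i(1), of \<mu>] and \<pi> = of_markov_multipolicies[OF \<phi>]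
  note space_P = space_law[OF gm \<gamma> \<pi>]
  interpret P: prob_space ?P by (rule prob_space_law[OF gm \<gamma> \<pi>])
  define B where "B x = {\<omega> \<in> PiE UNIV (stages G). state_at \<omega> (Suc 0) = fst x \<and> goals_at \<omega> (Suc 0) = snd x}" for x
  define S where "S x = {\<omega> \<in> PiE UNIV (stages ?G). ereal (of_rat (snd x k)) \<le> passage_reward ?G 0 k \<omega>}" for x :: "'a \<times> 'b goals"
  \<comment> \<open>The goal is met from time 1 on, and \<open>x\<close> gives the state and goals at time 1.\<close>
  define E where "E x = {\<omega> \<in> B x. (\<lambda>t. \<omega> (Suc 0 + t)) \<in> S x}" for x
  have S: "S x \<in> sets (PiM UNIV (stage_space ?G))" for x
  proof -
    have "S x = {\<omega> \<in> space (PiM UNIV (stage_space ?G)). ereal (of_rat (snd x k)) \<le> passage_reward ?G 0 k \<omega>}"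
      by (simp add: S_def space_PiM_stage_space)
    also have "\<dots> \<in> sets (PiM UNIV (stage_space ?G))" by measurable
    finally show ?thesis .
  qed
  have E: "E x \<in> sets ?P" "B x \<in> sets ?P" "emeasure ?P (E x) = emeasure ?P (B x) * ennreal (F G \<phi> (Suc 0) k (fst x) (snd x))"
    if "x \<in> ?C" for x
  proof -
    let ?P' = "law ?G (return_pmf x) (of_markov (\<lambda>l t. \<phi> l (Suc 0 + t)))"
    have x: "fst x \<in> states G (Suc 0)" using that by auto
    note * = markov_property[where \<mu> = "snd x", OF gm \<gamma> \<phi> x S[of x], folded B_def E_def, unfolded prod.collapse]
    note shifted = game_model_shift[OF gm] initial_distribution_return[of "fst x" ?G "snd x", unfolded prod.collapse]
      of_markov_multipolicies[OF markov_multipolicies_shift[OF \<phi>]]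
    interpret P': prob_space ?P' using x by (intro prob_space_law shifted) simp
    have "space ?P' = PiE UNIV (stages ?G)" using x by (intro space_law shifted) simp
    then have "emeasure ?P' (S x) = ennreal (F G \<phi> (Suc 0) k (fst x) (snd x))"
      unfolding F_def F0_def S_def P'.emeasure_eq_measure prod.collapse by simp
    with * show "E x \<in> sets ?P" "B x \<in> sets ?P"
      "emeasure ?P (E x) = emeasure ?P (B x) * ennreal (F G \<phi> (Suc 0) k (fst x) (snd x))" by simp_all
  qed
  have met: "AE \<omega> in ?P. ereal (of_rat (\<mu> k)) \<le> passage_reward G 0 k \<omega> \<longleftrightarrow> \<omega> \<in> (\<Union>x\<in>?C. E x)"
    using AE_initial[OF gm i(1) \<pi>, of \<mu>] AE_next_goals[OF gm \<gamma> \<pi>] AE_space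
  proof eventually_elim
    case (elim \<omega>)
    let ?r = "reward G 0 k (state_at \<omega> 0) (acts_at \<omega> 0)"
    have \<omega>: "\<omega> \<in> PiE UNIV (stages G)" using elim by (simp add: space_P)
    have "ereal (of_rat (\<mu> k)) \<le> passage_reward G 0 k \<omega> \<longleftrightarrow>
        ereal (of_rat (\<mu> k)) \<le> ereal (of_rat ?r) + passage_reward G (Suc 0) k \<omega>"
      using passage_reward_split_first[OF gm \<omega>] elim i(2) by simp
    also have "\<dots> \<longleftrightarrow> ereal (of_rat (\<mu> k - ?r)) \<le> passage_reward G (Suc 0) k \<omega>"
      by (cases "passage_reward G (Suc 0) k \<omega>") (auto simp: of_rat_diff)
    also have "\<mu> k - ?r = goals_at \<omega> (Suc 0) k"
      using elim by (simp add: next_goals_def)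
    also have "ereal (of_rat (goals_at \<omega> (Suc 0) k)) \<le> passage_reward G (Suc 0) k \<omega> \<longleftrightarrow>
        \<omega> \<in> (\<Union>x\<in>?C. E x)"
    proof -
      have "\<omega> (Suc 0) \<in> stages G (Suc 0)" "(\<lambda>t. \<omega> (Suc 0 + t)) \<in> PiE UNIV (stages ?G)"
        using \<omega> by (auto simp: PiE_iff stages_shift)
      then show ?thesis
        using \<omega> by (auto simp: E_def B_def S_def stages_def passage_reward_shift[of G "Suc 0"])
    qed
    finally show ?case .
  qed
  have count: "countable ?C" using gm by (intro countable_SIGMA countableI_type) (simp add: game_model_def)
  moreover from this have "(\<Union>x\<in>?C. E x) \<in> sets ?P"
    using E(1) by (intro sets.countable_UN') auto
  moreover have "AE \<omega> in ?P. \<omega> \<in> {\<omega> \<in> space ?P. ereal (of_rat (\<mu> k)) \<le> passage_reward G 0 k \<omega>} \<longleftrightarrow>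
      \<omega> \<in> (\<Union>x\<in>?C. E x)"
    using met AE_space by eventually_elim simp
  ultimately have "emeasure ?P {\<omega> \<in> space ?P. ereal (of_rat (\<mu> k)) \<le> passage_reward G 0 k \<omega>} =
      emeasure ?P (\<Union>x\<in>?C. E x)"
    by (intro emeasure_eq_AE sets_goal_met[OF gm \<gamma> \<pi>])
  also have "\<dots> = (\<integral>\<^sup>+x. emeasure ?P (E x) \<partial>count_space ?C)"
    using E(1) count
    by (intro emeasure_UN_countable) (auto simp: disjoint_family_on_def E_def B_def)
  also have "\<dots> = (\<integral>\<^sup>+x. ennreal (pmf (map_pmf snd ?H) x) * ennreal (F G \<phi> (Suc 0) k (fst x) (snd x)) \<partial>count_space ?C)"
  proof (intro nn_integral_cong)
    fix x assume "x \<in> space (count_space ?C)"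
    then have x: "x \<in> ?C" by simp
    have "emeasure ?P (B x) = (\<integral>\<^sup>+\<omega>. indicator {x} (snd (history_at \<omega> (Suc 0))) \<partial>?P)"
      unfolding nn_integral_indicator[OF E(2)[OF x], symmetric]
      by (intro nn_integral_cong) (auto simp: B_def space_P history_at_def indicator_def)
    also have "\<dots> = (\<integral>\<^sup>+h. indicator {x} (snd h) \<partial>?H)"
      by (rule nn_integral_history_at[OF gm \<gamma> \<pi>, of "\<lambda>h. indicator {x} (snd h)"])
    also have "\<dots> = (\<integral>\<^sup>+y. indicator {x} y \<partial>map_pmf snd ?H)"
      by (rule nn_integral_map_pmf[symmetric])
    also have "\<dots> = ennreal (pmf (map_pmf snd ?H) x)"
      by (subst nn_integral_indicator) (simp_all add: emeasure_pmf_single)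
    finally show "emeasure ?P (E x) = ennreal (pmf (map_pmf snd ?H) x) * ennreal (F G \<phi> (Suc 0) k (fst x) (snd x))"
      by (simp add: E(3)[OF x])
  qed
  also have "\<dots> = (\<integral>\<^sup>+x. ennreal (pmf (map_pmf snd ?H) x) * ennreal (F G \<phi> (Suc 0) k (fst x) (snd x)) \<partial>count_space UNIV)"
  proof (rule nn_integral_count_space_eq)
    fix x assume "x \<in> UNIV - ?C"
    moreover have "cur_state h \<in> states G (Suc 0)" if "h \<in> set_pmf ?H" for h
      using that set_history_pmf[OF gm \<gamma> \<pi>, of "Suc 0"] by (intro cur_state_histories) blast
    ultimately have "x \<notin> set_pmf (map_pmf snd ?H)"
      by (auto simp del: history_pmf.simps)
    then have "pmf (map_pmf snd ?H) x = 0" unfolding set_pmf_iff by simp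
    then show "ennreal (pmf (map_pmf snd ?H) x) * ennreal (F G \<phi> (Suc 0) k (fst x) (snd x)) = 0" by simp
  qed simp
  also have "\<dots> = (\<integral>\<^sup>+x. ennreal (F G \<phi> (Suc 0) k (fst x) (snd x)) \<partial>map_pmf snd ?H)"
    by (rule nn_integral_measure_pmf[symmetric])
  also have "\<dots> = (\<integral>\<^sup>+h. ennreal (F G \<phi> (Suc 0) k (cur_state h) (cur_goals h)) \<partial>?H)"
    by (rule nn_integral_map_pmf)
  finally show ?thesis
    by (simp add: F0_def P.emeasure_eq_measure)
qed

lemma F0_eq_T_mixed:
  assumes gm: "game_model G" and i: "i \<in> states G 0" "i \<notin> target G" and \<phi>: "\<phi> \<in> markov_multipolicies G"
  shows "F0 G (of_markov \<phi>) k i \<mu> = T_mixed G 0 k (\<lambda>l. \<phi> l 0 i \<mu>) (F G \<phi> (Suc 0) k) i \<mu>"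
proof -
  let ?F = "F G \<phi> (Suc 0) k"
  have F: "?F \<in> goal_functions G (Suc 0) k" by (rule F_goal_functions[OF gm \<phi>])
  have "with_boundary G k ?F = ?F"
    by (intro ext) (simp add: with_boundary_def F_target[OF gm _ \<phi>])
  moreover have "set_pmf (\<phi> l 0 i \<mu>) \<subseteq> acts G 0 l i" for l
    using \<phi> i(1) by (auto simp: markov_multipolicies_def markov_policies_def)
  ultimately have "ennreal (F0 G (of_markov \<phi>) k i \<mu>) = ennreal (T_mixed G 0 k (\<lambda>l. \<phi> l 0 i \<mu>) ?F i \<mu>)"
    unfolding F0_first_step[OF assms]
    by (simp add: T_mixed_eq_nn_integral[OF gm i(1) _ F] next_history_def joint_action_pmf_def of_markov_def)
  moreover have "0 \<le> T_mixed G 0 k (\<lambda>l. \<phi> l 0 i \<mu>) ?F i \<mu>"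
    unfolding T_mixed_def by (intro sum_nonneg mult_nonneg_nonneg T_action_nonneg F prod_nonneg) auto
  ultimately show ?thesis by (simp add: F0_def)
qed

lemma shift_game_shift_game: "shift_game m (shift_game n G) = shift_game (n + m) G"
  by (simp add: shift_game_def add.assoc)

lemma T_mixed_shift: "T_mixed (shift_game n G) t = T_mixed G (n + t)"
  by (intro ext) (simp add: T_mixed_def T_action_def joint_acts_def next_goals_def shift_game_def)

lemma F_eq_T_mixed:
  assumes gm: "game_model G" and i: "i \<in> states G n" "i \<notin> target G" and \<phi>: "\<phi> \<in> markov_multipolicies G"
  shows "F G \<phi> n k i \<mu> = T_mixed G n k (\<lambda>l. \<phi> l n i \<mu>) (F G \<phi> (Suc n) k) i \<mu>"
proof -
  have "F (shift_game n G) (\<lambda>l t. \<phi> l (n + t)) (Suc 0) = F G \<phi> (Suc n)"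
    by (intro ext) (simp add: F_def shift_game_shift_game)
  then show ?thesis
    using F0_eq_T_mixed[OF game_model_shift[OF gm] _ _ markov_multipolicies_shift[OF \<phi>], of i n k \<mu>] i
    by (simp add: F_def T_mixed_shift)
qed

section \<open>The comparison theorem\<close>

lemma goal_functions_shift: "goal_functions (shift_game n G) t = goal_functions G (n + t)"
  by (intro ext) (simp add: goal_functions_def)

lemma markov_comparison_le:
  assumes gm: "game_model G" and A: "assumption_A G" and \<phi>: "\<phi> \<in> markov_multipolicies G"
    and u: "\<And>n. u n \<in> goal_functions G n k"
    and le: "\<And>n i \<mu>. i \<in> states G n - target G \<Longrightarrow>
      u n i \<mu> \<le> T_mixed G n k (\<lambda>l. \<phi> l n i \<mu>) (u (Suc n)) i \<mu>"
    and i: "attainable G n i" "i \<notin> target G"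
  shows "u n i \<mu> \<le> F G \<phi> n k i \<mu>"
proof -
  have "u (n + 0) i \<mu> \<le> F G \<phi> n k i \<mu>"
    unfolding F_def
  proof (rule comparison_le[where u = "\<lambda>t. u (n + t)", OF _ _ _ _ _ AE_passage_time_shift[OF gm A \<phi> i]])
    fix t and h :: "('a, 'b, 'c) history"
    assume "h \<in> histories (shift_game n G) t" "cur_state h \<notin> target (shift_game n G)"
    then show "u (n + t) (cur_state h) (cur_goals h)
      \<le> T_mixed (shift_game n G) t k (\<lambda>l. of_markov (\<lambda>l t. \<phi> l (n + t)) l t h) (u (n + Suc t)) (cur_state h) (cur_goals h)"
      using le[of "cur_state h" "n + t" "cur_goals h"] cur_state_histories[of h "shift_game n G" t]
      by (simp add: T_mixed_shift of_markov_def)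
  qed (use attainable_states[OF gm i(1)] i(2) u in \<open>simp_all add: goal_functions_shift game_model_shift gm
        of_markov_multipolicies markov_multipolicies_shift \<phi>\<close>)
  then show ?thesis by simp
qed

lemma markov_comparison_ge:
  assumes gm: "game_model G" and A: "assumption_A G" and \<phi>: "\<phi> \<in> markov_multipolicies G"
    and u: "\<And>n. u n \<in> goal_functions G n k"
    and ge: "\<And>n i \<mu>. i \<in> states G n - target G \<Longrightarrow>
      u n i \<mu> \<ge> T_mixed G n k (\<lambda>l. \<phi> l n i \<mu>) (u (Suc n)) i \<mu>"
    and i: "attainable G n i" "i \<notin> target G"
  shows "u n i \<mu> \<ge> F G \<phi> n k i \<mu>"
proof -
  have "u (n + 0) i \<mu> \<ge> F G \<phi> n k i \<mu>"
    unfolding F_def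
  proof (rule comparison_ge[where u = "\<lambda>t. u (n + t)", OF _ _ _ _ _ AE_passage_time_shift[OF gm A \<phi> i]])
    fix t and h :: "('a, 'b, 'c) history"
    assume "h \<in> histories (shift_game n G) t" "cur_state h \<notin> target (shift_game n G)"
    then show "u (n + t) (cur_state h) (cur_goals h)
      \<ge> T_mixed (shift_game n G) t k (\<lambda>l. of_markov (\<lambda>l t. \<phi> l (n + t)) l t h) (u (n + Suc t)) (cur_state h) (cur_goals h)"
      using ge[of "cur_state h" "n + t" "cur_goals h"] cur_state_histories[of h "shift_game n G" t]
      by (simp add: T_mixed_shift of_markov_def)
  qed (use attainable_states[OF gm i(1)] i(2) u in \<open>simp_all add: goal_functions_shift game_model_shift gm
        of_markov_multipolicies markov_multipolicies_shift \<phi>\<close>)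
  then show ?thesis by simp
qed


theorem theorem1:
  fixes G :: "('s, 'k::finite, 'a) game"
  assumes "game_model G"
    and "assumption_A G"
  shows
    "(\<forall>k. \<forall>\<pi>\<in>multipolicies G. \<forall>u. (\<forall>n. u n \<in> goal_functions G n k) \<longrightarrow>
        ((\<forall>n. \<forall>h\<in>histories G n. cur_state h \<notin> target G \<longrightarrow>
            u n (cur_state h) (cur_goals h)
              \<le> T_mixed G n k (\<lambda>l. \<pi> l n h) (u (Suc n)) (cur_state h) (cur_goals h)) \<longrightarrow>
         (\<forall>i\<in>states G 0 - target G. \<forall>\<mu>. u 0 i \<mu> \<le> F0 G \<pi> k i \<mu>)) \<and>
        ((\<forall>n. \<forall>h\<in>histories G n. cur_state h \<notin> target G \<longrightarrow>
            u n (cur_state h) (cur_goals h)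
              \<ge> T_mixed G n k (\<lambda>l. \<pi> l n h) (u (Suc n)) (cur_state h) (cur_goals h)) \<longrightarrow>
         (\<forall>i\<in>states G 0 - target G. \<forall>\<mu>. u 0 i \<mu> \<ge> F0 G \<pi> k i \<mu>)))
     \<and>
     (\<forall>k. \<forall>\<phi>\<in>markov_multipolicies G. \<forall>u. (\<forall>n. u n \<in> goal_functions G n k) \<longrightarrow>
        ((\<forall>n. \<forall>i\<in>states G n - target G. \<forall>\<mu>.
            u n i \<mu> \<le> T_mixed G n k (\<lambda>l. \<phi> l n i \<mu>) (u (Suc n)) i \<mu>) \<longrightarrow>
         (\<forall>n. \<forall>i\<in>states G n - target G. attainable G n i \<longrightarrow> (\<forall>\<mu>. u n i \<mu> \<le> F G \<phi> n k i \<mu>))) \<and>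
        ((\<forall>n. \<forall>i\<in>states G n - target G. \<forall>\<mu>.
            u n i \<mu> \<ge> T_mixed G n k (\<lambda>l. \<phi> l n i \<mu>) (u (Suc n)) i \<mu>) \<longrightarrow>
         (\<forall>n. \<forall>i\<in>states G n - target G. attainable G n i \<longrightarrow> (\<forall>\<mu>. u n i \<mu> \<ge> F G \<phi> n k i \<mu>))))
     \<and>
     (\<forall>k. \<forall>\<phi>\<in>markov_multipolicies G.
        (\<forall>n. F G \<phi> n k \<in> goal_functions G n k) \<and>
        (\<forall>n. \<forall>i\<in>states G n - target G. \<forall>\<mu>.
            F G \<phi> n k i \<mu> = T_mixed G n k (\<lambda>l. \<phi> l n i \<mu>) (F G \<phi> (Suc n) k) i \<mu>) \<and>
        (\<forall>u. (\<forall>n. u n \<in> goal_functions G n k) \<longrightarrow>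
             (\<forall>n. \<forall>i\<in>states G n - target G. \<forall>\<mu>.
                u n i \<mu> = T_mixed G n k (\<lambda>l. \<phi> l n i \<mu>) (u (Suc n)) i \<mu>) \<longrightarrow>
             (\<forall>n. \<forall>i\<in>states G n - target G. attainable G n i \<longrightarrow> (\<forall>\<mu>. u n i \<mu> = F G \<phi> n k i \<mu>))))"
proof (intro conjI allI ballI impI, goal_cases)
  case (1 k \<pi> u i \<mu>)
  then show ?case
    using assms by (intro comparison_le AE_passage_time_0) simp_all
next
  case (2 k \<pi> u i \<mu>)
  then show ?case
    using assms by (intro comparison_ge AE_passage_time_0) simp_all
next
  case (3 k \<phi> u n i \<mu>)
  then show ?case
    using assms by (intro markov_comparison_le) simp_all
next
  case (4 k \<phi> u n i \<mu>)
  then show ?case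
    using assms by (intro markov_comparison_ge) simp_all
next
  case (5 k \<phi> n)
  then show ?case
    using assms(1) by (intro F_goal_functions)
next
  case (6 k \<phi> n i \<mu>)
  then show ?case
    using assms(1) by (intro F_eq_T_mixed) simp_all
next
  case (7 k \<phi> u n i \<mu>)
  then show ?case
    using assms by (intro antisym markov_comparison_le markov_comparison_ge) simp_all
qed

end
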